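(* Let $d\ge 1$ be an integer and $1<p<\infty$. Let $E$ be a periodic connected open subset of $\mathbb{R}^d$ with Lipschitz boundary and let $\Omega$ be a bounded open subset of $\mathbb{R}^d$. Then there exist $R=R(E)>0$ and $k_0>0$ such that for all $\varepsilon>0$ there exists a linear and continuous extension operator $T_\varepsilon: L^p(\Omega\cap\varepsilon E)\to L^p(\Omega)$ such that for all $r>0$ and for all $u\in L^p(\Omega\cap\varepsilon E)$, $$T_\varepsilon(u)=u\quad\text{a.e. in }\Omega\cap\varepsilon E,$$ $$\int_{\Omega(\varepsilon k_0)}|T_\varepsilon(u)|^p\,dx\le c_1\int_{\Omega\cap\varepsilon E}|u|^p\,dx,$$ $$\int_{(\Omega(\varepsilon k_0))^2\cap D_{\varepsilon R}}|T_\varepsilon(u)(x)-T_\varepsilon(u)(y)|^p\,dx\,dy\le c_2(r)\int_{(\Omega\cap\varepsilon E)^2\cap D_{\varepsilon r}}|u(x)-u(y)|^p\,dx\,dy,$$ where the positive constants $c_1$ and $c_2$ depend on $E$ and $d$ (and on the fixed exponent $p$) and, in addition, $c_2$ depends also on $r$, but both are independent of $\varepsilon$.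
   Context: A set $E\subset\mathbb{R}^d$ is periodic if $E+e_i=E$ for every $i=1,\dots,d$, where $(e_i)$ is the canonical basis of $\mathbb{R}^d$. For $\lambda>0$, $\lambda E=\{\lambda x: x\in E\}$ and $\Omega(\lambda)=\{x\in\Omega: \operatorname{dist}(x,\partial\Omega)>\lambda\}$. For $\rho>0$, $D_\rho=\{(x,y)\in\mathbb{R}^d\times\mathbb{R}^d: |x-y|\le\rho\}$. For a set $A$, $A^2=A\times A$. An open set $E\subset\mathbb{R}^d$ has Lipschitz boundary at $x\in\partial E$ if there exist a coordinate system $(y_1,\dots,y_d)$, a Lipschitz function $\Phi$ of $d-1$ variables, and an open rectangle $U_x$ in the $y$-coordinates, centred at $x$, such that $E\cap U_x=\{y\in U_x: y_d<\Phi(y_1,\dots,y_{d-1})\}$ and $\partial E$ splits $U_x$ into two connected sets, $E\cap U_x$ and $U_x\setminus\overline{E}$. If this holds for every $x\in\partial E$ with the same Lipschitz constant, $E$ has Lipschitz boundary. *)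

theory Defs
  imports "HOL-Analysis.Analysis"
begin

definition periodic_set :: "(real ^ 'n) set \<Rightarrow> bool" where
  "periodic_set E \<longleftrightarrow> (\<forall>i. (\<lambda>x. x + axis i 1) ` E = E)"

text \<open>The coordinate system is Cartesian, i.e. given by an isometry \<open>y\<close> of the space (origin, axes
  and orientation are free), and \<open>k\<close> is the distinguished coordinate (the last one, up to
  relabelling the axes). A function of the \<open>d - 1\<close> remaining variables is a function on the whole
  space that does not depend on the coordinate \<open>k\<close>; its Lipschitz constant is unaffected.
  As \<open>E\<close> will be open, \<open>U - frontier E\<close> is the disjoint union of \<open>E \<inter> U\<close> and \<open>U - closure E\<close>;
  both are nonempty since \<open>x\<close> is a boundary point.\<close>

definition lipschitz_boundary_at :: "real \<Rightarrow> (real ^ 'n) set \<Rightarrow> real ^ 'n \<Rightarrow> bool" where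
  "lipschitz_boundary_at L E x \<longleftrightarrow>
    (\<exists>(y :: real ^ 'n \<Rightarrow> real ^ 'n) (k :: 'n) (\<Phi> :: real ^ 'n \<Rightarrow> real) (a :: real ^ 'n) U.
      (\<forall>s t. dist (y s) (y t) = dist s t) \<and>
      (\<forall>s t. (\<forall>i. i \<noteq> k \<longrightarrow> s $ i = t $ i) \<longrightarrow> \<Phi> s = \<Phi> t) \<and>
      L-lipschitz_on UNIV \<Phi> \<and>
      (\<forall>i. 0 < a $ i) \<and>
      U = {z. y z \<in> box (y x - a) (y x + a)} \<and>
      E \<inter> U = {z \<in> U. y z $ k < \<Phi> (y z)} \<and>
      connected (E \<inter> U) \<and> connected (U - closure E))"

definition lipschitz_boundary :: "(real ^ 'n) set \<Rightarrow> bool" where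
  "lipschitz_boundary E \<longleftrightarrow> (\<exists>L. \<forall>x \<in> frontier E. lipschitz_boundary_at L E x)"

text \<open>The set \<open>\<Omega>(t)\<close>. The convention \<open>infdist x {} = 0\<close> is irrelevant for bounded \<open>\<Omega>\<close>: there
  \<open>frontier \<Omega> = {}\<close> only if \<open>\<Omega> = {}\<close>.\<close>

definition inner_set :: "(real ^ 'n) set \<Rightarrow> real \<Rightarrow> (real ^ 'n) set" where
  "inner_set \<Omega> t = {x \<in> \<Omega>. infdist x (frontier \<Omega>) > t}"

definition strip :: "real \<Rightarrow> ((real ^ 'n) \<times> (real ^ 'n)) set" where
  "strip \<rho> = {(x, y). norm (x - y) \<le> \<rho>}"

text \<open>Elements of \<open>L\<^sup>p(S)\<close> are given by representatives, functions on the whole space whose values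
  outside \<open>S\<close> are irrelevant; equality in \<open>L\<^sup>p(S)\<close> is equality almost everywhere on \<open>S\<close>.\<close>

definition Lp :: "real \<Rightarrow> (real ^ 'n) set \<Rightarrow> (real ^ 'n \<Rightarrow> real) set" where
  "Lp p S = {u \<in> borel_measurable (lebesgue_on S). integrable (lebesgue_on S) (\<lambda>x. \<bar>u x\<bar> powr p)}"

definition Lp_norm :: "real \<Rightarrow> (real ^ 'n) set \<Rightarrow> (real ^ 'n \<Rightarrow> real) \<Rightarrow> real" where
  "Lp_norm p S u = (\<integral>x. \<bar>u x\<bar> powr p \<partial>lebesgue_on S) powr (1 / p)"

text \<open>Linear and continuous operators \<open>L\<^sup>p(A) \<rightarrow> L\<^sup>p(B)\<close>, in terms of representatives: the second
  conjunct says that the operator is well defined on almost-everywhere classes.\<close>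

definition continuous_linear_Lp ::
  "real \<Rightarrow> (real ^ 'n) set \<Rightarrow> (real ^ 'n) set \<Rightarrow> ((real ^ 'n \<Rightarrow> real) \<Rightarrow> (real ^ 'n \<Rightarrow> real)) \<Rightarrow> bool" where
  "continuous_linear_Lp p A B T \<longleftrightarrow>
    (\<forall>u \<in> Lp p A. T u \<in> Lp p B) \<and>
    (\<forall>u \<in> Lp p A. \<forall>v \<in> Lp p A.
      (AE x in lebesgue_on A. u x = v x) \<longrightarrow> (AE x in lebesgue_on B. T u x = T v x)) \<and>
    (\<forall>u \<in> Lp p A. \<forall>v \<in> Lp p A.
      AE x in lebesgue_on B. T (\<lambda>z. u z + v z) x = T u x + T v x) \<and>
    (\<forall>u \<in> Lp p A. \<forall>c. AE x in lebesgue_on B. T (\<lambda>z. c * u z) x = c * T u x) \<and>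
    (\<forall>u \<in> Lp p A. \<forall>e>0. \<exists>\<delta>>0. \<forall>v \<in> Lp p A.
      Lp_norm p A (\<lambda>z. v z - u z) < \<delta> \<longrightarrow> Lp_norm p B (\<lambda>z. T v z - T u z) < e)"

end

theory Submission
  imports Defs
begin

text \<open>
  Since \<open>E\<close> is open and periodic, finitely many translates of \<open>E\<close> cover the space. This gives a map
  \<open>\<psi>\<close> of the space into \<open>\<epsilon>E\<close> which is the identity on \<open>\<epsilon>E\<close>, moves points by at most a multiple of
  \<open>\<epsilon>\<close>, and is piecewise one of finitely many translations; the extension operator is
  \<open>u \<mapsto> u \<circ> \<psi>\<close>, set to \<open>0\<close> where \<open>\<psi>\<close> leaves \<open>\<Omega>\<close>. The nonlocal bound is then a statement about \<open>\<epsilon>E\<close>: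
  increments of \<open>u\<close> over distances of order \<open>\<epsilon>\<close> are controlled by increments over
  distances \<open>\<epsilon>r\<close>. Any two points of \<open>E\<close> at bounded distance are joined by a chain of boundedly many
  balls of equal radius in \<open>E\<close> whose consecutive members are \<open>r\<close>-close. Averaging
  \<open>|u x - u y|\<^sup>p\<close> along the chain bounds it by integrals of the \<open>r\<close>-increments over fixed
  neighbourhoods of \<open>x\<close> and \<open>y\<close>. These no longer depend on the chain, so no measurable choice of
  chains is needed.
\<close>

section \<open>Chains of balls in periodic domains\<close>

text \<open>The chart rectangle itself serves as \<open>U\<close>: the isometry \<open>y\<close> is
  continuous and preserves distances, so the preimage of the bounded open box is open and bounded.
  Boundedness is what later keeps connecting sets bounded.\<close>

lemma lipschitz_boundary_neighbourhood:
  fixes E :: "(real ^ 'n) set"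
  assumes "lipschitz_boundary_at L E x"
  shows "\<exists>U. open U \<and> bounded U \<and> x \<in> U \<and> connected (E \<inter> U)"
proof -
  obtain y :: "real ^ 'n \<Rightarrow> real ^ 'n" and a U where y: "\<forall>s t. dist (y s) (y t) = dist s t"
    and a: "\<forall>i. 0 < a $ i" and U: "U = {z. y z \<in> box (y x - a) (y x + a)}" and C: "connected (E \<inter> U)"
    using assms unfolding lipschitz_boundary_at_def by blast
  have "continuous_on UNIV y"
    using y by (auto simp: continuous_on_iff)
  then have "open (y -` box (y x - a) (y x + a))" by (intro open_vimage open_box)
  moreover have "y -` box (y x - a) (y x + a) = U" by (auto simp: U)
  moreover have "bounded U"
  proof -
    obtain b where "\<And>p. p \<in> box (y x - a) (y x + a) \<Longrightarrow> dist (y x) p \<le> b"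
      using bounded_box bounded_any_center[of _ "y x"] by blast
    then have "\<forall>z\<in>U. dist x z \<le> b" using y by (metis U mem_Collect_eq)
    then show ?thesis unfolding bounded_def by blast
  qed
  moreover have "x \<in> U" using a by (simp add: U mem_box_cart)
  ultimately show ?thesis using C by auto
qed

text \<open>One coordinate at a time: natural multiples of a unit shift by induction, negative ones
  by shifting back; a general integer vector is then a finite sum of such multiples.\<close>

lemma integer_shift_invariant:
  fixes Q :: "real ^ 'n \<Rightarrow> bool" and k :: "'n \<Rightarrow> int"
  assumes Q: "\<And>v i. Q (v + axis i 1) \<longleftrightarrow> Q v"
  shows "Q (v + (\<chi> i. of_int (k i))) \<longleftrightarrow> Q v"
proof -
  have nat: "Q (v + of_nat n *\<^sub>R axis i 1) \<longleftrightarrow> Q v" for n v i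
  proof (induction n)
    case (Suc n)
    have "v + of_nat (Suc n) *\<^sub>R axis i 1 = (v + of_nat n *\<^sub>R axis i 1) + axis i (1::real)"
      by (simp add: algebra_simps)
    then show ?case using Q Suc by metis
  qed simp
  have int: "Q (v + of_int c *\<^sub>R axis i 1) \<longleftrightarrow> Q v" for c v i
  proof (cases c)
    case (nonneg n) then show ?thesis using nat[of v n i] by simp
  next
    case (neg n)
    \<comment> \<open>Here \<open>neg n\<close> means that \<open>c\<close> is minus
      \<open>Suc n\<close>, so \<open>Suc n\<close> unit shifts lead back to
      \<open>v\<close>.\<close>
    then have "v + of_int c *\<^sub>R axis i 1 + of_nat (Suc n) *\<^sub>R axis i (1::real) = v"
      by (simp add: algebra_simps flip: scaleR_add_left)
    then show ?thesis using nat[of "v + of_int c *\<^sub>R axis i 1" "Suc n" i] by metis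
  qed
  have "Q (v + (\<Sum>i\<in>F. of_int (k i) *\<^sub>R axis i 1)) \<longleftrightarrow> Q v" if "finite F" for F
    using that
  proof (induction F arbitrary: v)
    case (insert i F)
    then show ?case using insert.IH[of "v + of_int (k i) *\<^sub>R axis i 1"] int[of v "k i" i] by (simp add: add.assoc)
  qed simp
  from this[of UNIV] show ?thesis
    using basis_expansion[of "\<chi> i. real_of_int (k i)"] by (simp add: scalar_mult_eq_scaleR)
qed

text \<open>Integer translations move \<open>x\<close> into the unit cube, where compactness applies.\<close>

lemma periodic_uniform:
  fixes P :: "real ^ 'n \<Rightarrow> real ^ 'n \<Rightarrow> nat \<Rightarrow> bool"
  assumes mono: "\<And>x y m n. P x y m \<Longrightarrow> m \<le> n \<Longrightarrow> P x y n"
    and shift: "\<And>x y n i. P (x + axis i 1) (y + axis i 1) n \<longleftrightarrow> P x y n"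
    and local: "\<And>x y. \<exists>U V n. open U \<and> open V \<and> x \<in> U \<and> y \<in> V \<and> (\<forall>x'\<in>U. \<forall>y'\<in>V. P x' y' n)"
  shows "\<exists>n. \<forall>x y. dist x y \<le> M \<longrightarrow> P x y n"
proof -
  let ?c = "cbox 0 (\<chi> i. 1) :: (real ^ 'n) set"
  obtain b where b: "\<And>x. x \<in> ?c \<Longrightarrow> norm x \<le> b"
    using bounded_cbox[unfolded bounded_iff] by meson
  \<comment> \<open>With \<open>x\<close> in the unit cube, the distance bound confines
    \<open>y\<close> to the ball of radius \<open>b + M\<close>, so a compact set of pairs
    suffices.\<close>
  define Z where "Z = ?c \<times> cball (0 :: real ^ 'n) (b + M)"
  have "compact Z" unfolding Z_def by (intro compact_Times compact_cbox compact_cball)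
  have "\<exists>W n. open W \<and> z \<in> W \<and> (\<forall>z'\<in>W. P (fst z') (snd z') n)" for z
  proof -
    obtain U V n where "open U" "open V" "fst z \<in> U" "snd z \<in> V" "\<forall>x'\<in>U. \<forall>y'\<in>V. P x' y' n"
      using local by meson
    then show ?thesis
      by (intro exI[of _ "U \<times> V"] exI[of _ n]) (auto simp: open_Times mem_Times_iff)
  qed
  then have "\<forall>z. \<exists>W n. open W \<and> z \<in> W \<and> (\<forall>z'\<in>W. P (fst z') (snd z') n)" by blast
  then obtain W n where "\<forall>z. open (W z) \<and> z \<in> W z \<and> (\<forall>z'\<in>W z. P (fst z') (snd z') (n z))"
    unfolding choice_iff by blast
  then have W: "open (W z)" "z \<in> W z" "\<And>z'. z' \<in> W z \<Longrightarrow> P (fst z') (snd z') (n z)" for z by blast+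
  obtain F where F: "finite F" "Z \<subseteq> (\<Union>z\<in>F. W z)"
    using compactE_image[OF \<open>compact Z\<close>, of Z W] W by (metis UN_I subsetI)
  \<comment> \<open>By monotonicity the largest index of the finite subcover works for all
    pairs.\<close>
  have "P x y (Max (n ` F))" if xy: "dist x y \<le> M" for x y
  proof -
    define k :: "real ^ 'n" where "k = (\<chi> i. of_int (- \<lfloor>x $ i\<rfloor>))"
    have in_c: "x + k \<in> ?c"
      by (auto simp: k_def mem_box_cart) linarith+
    have "norm (y + k) \<le> norm (x + k) + dist x y"
      using norm_triangle_ineq[of "x + k" "y - x"] by (simp add: dist_norm norm_minus_commute add.commute)
    with b[OF in_c] xy have "(x + k, y + k) \<in> Z" using in_c by (simp add: Z_def)
    with F obtain z where z: "z \<in> F" "(x + k, y + k) \<in> W z" by blast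
    then have "P (x + k) (y + k) (n z)" using W(3) by fastforce
    then have "P (x + k) (y + k) (Max (n ` F))" using mono z F by (simp add: Max_ge)
    \<comment> \<open>Both points are shifted by the same vector, so the invariance lemma is applied
      to a predicate of that vector alone, at 0.\<close>
    moreover have "P (x + k) (y + k) m = P (x + 0) (y + 0) m" for m
      unfolding k_def
      using integer_shift_invariant[of "\<lambda>v. P (x + v) (y + v) m" 0 "\<lambda>i. - \<lfloor>x $ i\<rfloor>"]
      by (simp add: shift add.assoc[symmetric])
    ultimately show ?thesis by simp
  qed
  then show ?thesis by blast
qed

text \<open>Being linked by finitely many steps of length at most \<delta> inside \<open>C\<close>
  is an equivalence relation with relatively open classes; a connected set has only one
  class.\<close>

lemma chain_in_connected:
  fixes C :: "'a::metric_space set"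
  assumes C: "connected C" "a \<in> C" "b \<in> C" and "\<delta> > 0"
  obtains w :: "nat \<Rightarrow> 'a" and N where "w 0 = a" "w N = b" "\<And>i. i \<le> N \<Longrightarrow> w i \<in> C"
    "\<And>i. i < N \<Longrightarrow> dist (w i) (w (Suc i)) \<le> \<delta>"
proof -
  let ?S = "\<lambda>x y. x \<in> C \<and> y \<in> C \<and> dist x y \<le> \<delta>"
  have sym: "symp ?S" by (auto simp: symp_def dist_commute)
  have "?S\<^sup>*\<^sup>* a b"
  proof (rule connected_equivalence_relation[OF C])
    show "?S\<^sup>*\<^sup>* y x" if "?S\<^sup>*\<^sup>* x y" for x y
      using that symp_rtranclp[OF sym] by (auto simp: symp_def)
    show "?S\<^sup>*\<^sup>* x z" if "?S\<^sup>*\<^sup>* x y" "?S\<^sup>*\<^sup>* y z" for x y z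
      using that by simp
    show "\<exists>T. openin (top_of_set C) T \<and> x \<in> T \<and> (\<forall>y\<in>T. ?S\<^sup>*\<^sup>* x y)" if "x \<in> C" for x
      using that \<open>\<delta> > 0\<close> by (intro exI[of _ "C \<inter> ball x \<delta>"]) (auto simp: less_imp_le)
  qed
  then obtain N where "(?S ^^ N) a b" by (rule rtranclp_imp_relpowp[THEN exE])
  then obtain w where w: "w 0 = a" "w N = b" "\<forall>i<N. ?S (w i) (w (Suc i))"
    unfolding relpowp_fun_conv by blast
  \<comment> \<open>The steps give membership for \<open>i < N\<close>; the last point is
    \<open>b\<close>.\<close>
  have "w i \<in> C" if "i \<le> N" for i
    using that w C by (cases "i < N") auto
  then show ?thesis using that w by blast
qed

section \<open>Connectedness of a periodic domain at bounded scale\<close>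

locale periodic_domain =
  fixes E :: "(real ^ 'n) set"
  assumes periodic: "periodic_set E" and conn: "connected E" and opn: "open E"
    and locally_connected: "\<And>x. x \<in> frontier E \<Longrightarrow> \<exists>U. open U \<and> bounded U \<and> x \<in> U \<and> connected (E \<inter> U)"
begin

lemma shift_iff [simp]: "x + axis i 1 \<in> E \<longleftrightarrow> x \<in> E"
proof -
  have *: "(\<lambda>x. x + axis i 1) ` E = E"
    using periodic by (simp add: periodic_set_def)
  show ?thesis
  proof
    assume "x + axis i 1 \<in> E"
    then have "x + axis i 1 \<in> (\<lambda>x. x + axis i 1) ` E" using * by simp
    then show "x \<in> E" by auto
  qed (use * in blast)
qed

lemma shift_iff' [simp]: "x - axis i 1 \<in> E \<longleftrightarrow> x \<in> E"
  using shift_iff[of "x - axis i 1" i] by simp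

text \<open>Around a point of the open set \<open>E\<close> a small ball does; at a boundary point
  the hypothesis does. An open neighbourhood of a closure point always meets
  \<open>E\<close>.\<close>

lemma neighbourhood:
  assumes "x \<in> closure E"
  shows "\<exists>U. open U \<and> bounded U \<and> x \<in> U \<and> connected (E \<inter> U) \<and> E \<inter> U \<noteq> {}"
proof -
  have "\<exists>U. open U \<and> bounded U \<and> x \<in> U \<and> connected (E \<inter> U)"
  proof (cases "x \<in> E")
    case True
    then obtain e where "e > 0" "ball x e \<subseteq> E" using opn open_contains_ball by blast
    then show ?thesis by (intro exI[of _ "ball x e"]) (simp add: inf_absorb2)
  next
    case False
    then have "x \<in> frontier E" using assms opn by (simp add: frontier_def interior_open)
    then show ?thesis by (rule locally_connected)
  qed
  then obtain U where U: "open U" "bounded U" "x \<in> U" "connected (E \<inter> U)" by blast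
  then have "U \<inter> E \<noteq> {}" using assms open_Int_closure_eq_empty[OF U(1), of E] by blast
  then show ?thesis using U by blast
qed

text \<open>Nearby points of \<open>E\<close> may be joined only by a detour; \<open>K\<close>
  bounds its extent. Locally, one connected set serves all pairs near a given pair: the pieces of
  \<open>E\<close> in two neighbourhoods, joined by a path in \<open>E\<close>. Compactness modulo
  integer translations makes the bound uniform.\<close>

lemma connecting_sets:
  obtains K where "K > 0"
    "\<And>x y. x \<in> E \<Longrightarrow> y \<in> E \<Longrightarrow> dist x y \<le> M \<Longrightarrow>
      \<exists>C. connected C \<and> C \<subseteq> E \<and> C \<subseteq> cball x K \<and> x \<in> C \<and> y \<in> C"
proof -
  define P where "P x y n \<longleftrightarrow> (x \<in> E \<longrightarrow> y \<in> E \<longrightarrow>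
      (\<exists>C. connected C \<and> C \<subseteq> E \<and> C \<subseteq> cball x (real n) \<and> x \<in> C \<and> y \<in> C))" for x y n
  have trans: "P (x + v) (y + v) n" if P: "P x y n" and v: "\<And>z. z + v \<in> E \<longleftrightarrow> z \<in> E" for x y v n
    unfolding P_def
  proof (intro impI)
    assume "x + v \<in> E" "y + v \<in> E"
    then have "x \<in> E" "y \<in> E" using v by auto
    then obtain C where "connected C" "C \<subseteq> E" "C \<subseteq> cball x (real n)" "x \<in> C" "y \<in> C"
      using P unfolding P_def by blast
    then show "\<exists>C. connected C \<and> C \<subseteq> E \<and> C \<subseteq> cball (x + v) (real n) \<and> x + v \<in> C \<and> y + v \<in> C"
      using v by (intro exI[of _ "(\<lambda>z. v + z) ` C"]) (auto simp: add.commute dist_norm intro!: connected_continuous_image continuous_intros)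
  qed
  have "\<exists>n. \<forall>x y. dist x y \<le> M \<longrightarrow> P x y n"
  proof (rule periodic_uniform[of P M])
    show "P x y n" if "P x y m" "m \<le> n" for x y m n
      using that unfolding P_def by (meson of_nat_mono order_trans subset_cball)
    show "P (x + axis i 1) (y + axis i 1) n \<longleftrightarrow> P x y n" for x y n i
      using trans[of x y n "axis i 1"] trans[of "x + axis i 1" "y + axis i 1" n "- axis i 1"] by auto
    show "\<exists>U V n. open U \<and> open V \<and> x \<in> U \<and> y \<in> V \<and> (\<forall>x'\<in>U. \<forall>y'\<in>V. P x' y' n)" for x y
    proof (cases "x \<in> closure E \<and> y \<in> closure E")
      \<comment> \<open>Off the closure of \<open>E\<close> the predicate holds vacuously on an open
        set.\<close>
      case False
      then consider "x \<in> - closure E" | "y \<in> - closure E" by blast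
      then show ?thesis
      proof cases
        case 1
        then show ?thesis using closure_subset[of E]
          by (intro exI[of _ "- closure E"] exI[of _ UNIV]) (auto simp: P_def)
      next
        case 2
        then show ?thesis using closure_subset[of E]
          by (intro exI[of _ UNIV] exI[of _ "- closure E"]) (auto simp: P_def)
      qed
    next
      case True
      then obtain U V where U: "open U" "bounded U" "x \<in> U" "connected (E \<inter> U)" "E \<inter> U \<noteq> {}"
        and V: "open V" "bounded V" "y \<in> V" "connected (E \<inter> V)" "E \<inter> V \<noteq> {}"
        using neighbourhood by meson
      then obtain z w where zw: "z \<in> E \<inter> U" "w \<in> E \<inter> V" by blast
      have "path_connected E" using conn opn connected_open_path_connected by blast
      then obtain g where g: "path g" "path_image g \<subseteq> E" "pathstart g = z" "pathfinish g = w"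
        using zw unfolding path_connected_def by blast
      have zg: "z \<in> path_image g" "w \<in> path_image g"
        using g by (metis pathstart_in_path_image, metis pathfinish_in_path_image)
      define C where "C = E \<inter> U \<union> path_image g \<union> E \<inter> V"
      have "connected (E \<inter> U \<union> path_image g)"
        using U zw g zg by (intro connected_Un connected_path_image) auto
      then have C: "connected C" unfolding C_def
        using V(4) by (rule connected_Un) (use zw zg in auto)
      have "bounded C" unfolding C_def
        using U V g by (auto intro: bounded_subset bounded_path_image)
      then obtain b where b: "\<And>c. c \<in> C \<Longrightarrow> norm c \<le> b" by (meson bounded_iff)
      \<comment> \<open>Twice the norm bound dominates the distance between any two points of
        \<open>C\<close>, so the same \<open>n\<close> works for every centre
        \<open>x'\<close>.\<close>
      obtain n :: nat where nb: "2 * b \<le> real n" using real_arch_simple by blast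
      have "P x' y' n" if "x' \<in> U" "y' \<in> V" for x' y'
        unfolding P_def
      proof (intro impI exI[of _ C] conjI C)
        assume E: "x' \<in> E" "y' \<in> E"
        show "C \<subseteq> E" "y' \<in> C" "x' \<in> C" using that E g by (auto simp: C_def)
        show "C \<subseteq> cball x' (real n)"
        proof
          fix c assume "c \<in> C"
          then have "dist x' c \<le> b + b"
            using b[of c] b[OF \<open>x' \<in> C\<close>] norm_triangle_ineq4[of x' c] by (simp add: dist_norm)
          then show "c \<in> cball x' (real n)" using nb by simp
        qed
      qed
      then show ?thesis using U V by blast
    qed
  qed
  then obtain n where n: "\<And>x y. dist x y \<le> M \<Longrightarrow> P x y n" by blast
  \<comment> \<open>The summand 1 makes the radius positive even for \<open>n = 0\<close>.\<close>
  have "\<exists>C. connected C \<and> C \<subseteq> E \<and> C \<subseteq> cball x (real n + 1) \<and> x \<in> C \<and> y \<in> C"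
    if "x \<in> E" "y \<in> E" "dist x y \<le> M" for x y
    using n[OF that(3)] that unfolding P_def by (meson order_trans subset_cball le_add_same_cancel1 zero_le_one)
  then show ?thesis by (intro that[of "real n + 1"]) auto
qed

text \<open>The bound \<open>K\<close> on the extent of the chains does not depend on their mesh \<open>r\<close>. This is the
  only place where the regularity of the boundary matters, and only through the connectedness of
  \<open>E\<close> near its boundary points.\<close>

lemma ball_chains:
  shows "\<exists>K>0. \<forall>r>0. r \<le> 1 \<longrightarrow> (\<exists>n \<sigma>. \<sigma> > 0 \<and> (\<forall>x\<in>E. \<forall>y\<in>E. dist x y \<le> M \<longrightarrow>
      (\<exists>w. (\<forall>i\<le>n. ball (w i) \<sigma> \<subseteq> E \<inter> cball x K) \<and>
        (\<forall>i<n. \<forall>\<xi>\<in>ball (w i) \<sigma>. \<forall>\<eta>\<in>ball (w (Suc i)) \<sigma>. dist \<xi> \<eta> \<le> r) \<and>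
        ball (w 0) \<sigma> \<subseteq> cball x r \<and> ball (w n) \<sigma> \<subseteq> cball y r)))"
proof -
  \<comment> \<open>\<open>K\<close> is fixed before \<open>r\<close>. The slack in
    \<open>M + 1\<close> allows closure points to be replaced by nearby points of
    \<open>E\<close>.\<close>
  obtain K where K: "K > 0" "\<And>x y. x \<in> E \<Longrightarrow> y \<in> E \<Longrightarrow> dist x y \<le> M + 1 \<Longrightarrow>
      \<exists>C. connected C \<and> C \<subseteq> E \<and> C \<subseteq> cball x K \<and> x \<in> C \<and> y \<in> C"
    using connecting_sets by metis
  show ?thesis
  proof (intro exI[of _ "K + 2"] conjI allI impI)
    show "K + 2 > 0" using K by simp
    fix r :: real assume r: "0 < r" "r \<le> 1"
    \<comment> \<open>A single number \<open>n\<close> encodes both the length of a chain and,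
      through \<open>s n\<close>, the radius of its balls. Larger \<open>n\<close> permits longer
      chains with smaller balls, so the predicate below is monotone as the compactness argument
      requires.\<close>
    define s where "s n = r / 4 / (real n + 1)" for n
    have s: "s n > 0" "s n \<le> r / 4" for n
      using r by (auto simp: s_def field_simps)
    have s_mono: "s n \<le> s m" if "m \<le> n" for m n
      using r that by (auto simp: s_def intro!: divide_left_mono)
    \<comment> \<open>Stated on the closure and with its own distance bound, so that the pairs to be
      treated form a closed set. Chains start and end only near \<open>x\<close> and
      \<open>y\<close>, as boundary points are not centres of balls in \<open>E\<close>.\<close>
    define P where "P x y n \<longleftrightarrow> (x \<in> closure E \<longrightarrow> y \<in> closure E \<longrightarrow> dist x y \<le> M \<longrightarrow>
        (\<exists>w. (\<forall>i\<le>n. ball (w i) (s n) \<subseteq> E \<and> dist x (w i) \<le> K + 1) \<and>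
          (\<forall>i<n. dist (w i) (w (Suc i)) \<le> r / 2) \<and> dist x (w 0) \<le> r / 2 \<and> dist y (w n) \<le> r / 2))" for x y n
    have trans: "P (x + v) (y + v) n" if P: "P x y n" and v: "\<And>z. z + v \<in> E \<longleftrightarrow> z \<in> E" for x y v n
      unfolding P_def
    proof (intro impI)
      have "(\<lambda>z. v + z) ` E = E"
      proof -
        have "z \<in> (\<lambda>z. v + z) ` E" if "z \<in> E" for z
          using that v[of "z - v"] by (intro image_eqI[of _ _ "z - v"]) auto
        then show ?thesis using v by (auto simp: add.commute)
      qed
      then have cl: "z + v \<in> closure E \<longleftrightarrow> z \<in> closure E" for z
        using closure_translation[of v E] by (metis (no_types, lifting) add.commute add_left_cancel imageE imageI)
      assume "x + v \<in> closure E" "y + v \<in> closure E" "dist (x + v) (y + v) \<le> M"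
      then have "x \<in> closure E" "y \<in> closure E" "dist x y \<le> M" by (simp_all add: cl)
      then obtain w where w: "\<forall>i\<le>n. ball (w i) (s n) \<subseteq> E \<and> dist x (w i) \<le> K + 1"
        "\<forall>i<n. dist (w i) (w (Suc i)) \<le> r / 2" "dist x (w 0) \<le> r / 2" "dist y (w n) \<le> r / 2"
        using P unfolding P_def by blast
      have "ball (w i + v) (s n) \<subseteq> E" if "i \<le> n" for i
      proof
        fix z assume "z \<in> ball (w i + v) (s n)"
        then have "z - v \<in> ball (w i) (s n)" by (simp add: dist_norm algebra_simps)
        then have "z - v \<in> E" using w that by blast
        then show "z \<in> E" using v[of "z - v"] by simp
      qed
      then show "\<exists>w. (\<forall>i\<le>n. ball (w i) (s n) \<subseteq> E \<and> dist (x + v) (w i) \<le> K + 1) \<and>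
          (\<forall>i<n. dist (w i) (w (Suc i)) \<le> r / 2) \<and> dist (x + v) (w 0) \<le> r / 2 \<and> dist (y + v) (w n) \<le> r / 2"
        using w by (intro exI[of _ "\<lambda>i. w i + v"]) auto
    qed
    have "\<exists>n. \<forall>x y. dist x y \<le> M \<longrightarrow> P x y n"
    proof (rule periodic_uniform[of P M])
      show "P x y n" if P: "P x y m" and mn: "m \<le> n" for x y m n
        unfolding P_def
      proof (intro impI)
        assume "x \<in> closure E" "y \<in> closure E" "dist x y \<le> M"
        then obtain w where w: "\<And>i. i\<le>m \<Longrightarrow> ball (w i) (s m) \<subseteq> E \<and> dist x (w i) \<le> K + 1"
          "\<And>i. i<m \<Longrightarrow> dist (w i) (w (Suc i)) \<le> r / 2" "dist x (w 0) \<le> r / 2" "dist y (w m) \<le> r / 2"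
          using P by (auto simp: P_def)
        \<comment> \<open>A short chain is lengthened by repeating its last point.\<close>
        have "dist (w (min i m)) (w (min (Suc i) m)) \<le> r / 2" for i
          using w(2)[of i] r by (cases "i < m") (auto simp: min_def)
        moreover have "ball (w (min i m)) (s n) \<subseteq> E" for i
          using w(1)[of "min i m"] subset_ball[OF s_mono[OF mn]] by fastforce
        ultimately show "\<exists>w. (\<forall>i\<le>n. ball (w i) (s n) \<subseteq> E \<and> dist x (w i) \<le> K + 1) \<and>
          (\<forall>i<n. dist (w i) (w (Suc i)) \<le> r / 2) \<and> dist x (w 0) \<le> r / 2 \<and> dist y (w n) \<le> r / 2"
          using w mn by (intro exI[of _ "\<lambda>i. w (min i m)"]) (auto simp: min_def)
      qed
      show "P (x + axis i 1) (y + axis i 1) n \<longleftrightarrow> P x y n" for x y n i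
        using trans[of x y n "axis i 1"] trans[of "x + axis i 1" "y + axis i 1" n "- axis i 1"] by auto
      show "\<exists>U V n. open U \<and> open V \<and> x \<in> U \<and> y \<in> V \<and> (\<forall>x'\<in>U. \<forall>y'\<in>V. P x' y' n)" for x y
      proof (cases "x \<in> closure E \<and> y \<in> closure E \<and> dist x y \<le> M")
        case False
        \<comment> \<open>The complement of \<open>D\<close> is open, and there the predicate is
          vacuous.\<close>
        define D where "D = (closure E \<times> closure E) \<inter> {z. dist (fst z) (snd z) \<le> M}"
        have "closed D" unfolding D_def
          by (intro closed_Int closed_Times closed_closure closed_Collect_le continuous_intros)
        moreover have "(x, y) \<in> - D" using False by (auto simp: D_def)
        ultimately obtain U V where "open U" "open V" "(x, y) \<in> U \<times> V" "U \<times> V \<subseteq> - D"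
          by (rule open_prod_elim[OF open_Compl])
        moreover have "P x' y' 0" if "x' \<in> U" "y' \<in> V" for x' y'
        proof -
          have "(x', y') \<notin> D" using that \<open>U \<times> V \<subseteq> - D\<close> by blast
          then show ?thesis by (simp add: P_def D_def)
        qed
        ultimately show ?thesis by blast
      next
        case True
        \<comment> \<open>The endpoints are approximated from within \<open>E\<close>, where the
          connecting set of extent \<open>K\<close> is available.\<close>
        then obtain z w where zw: "z \<in> E" "w \<in> E" "dist z x < r / 4" "dist w y < r / 4"
          using r closure_approachable[of x E] closure_approachable[of y E] by (meson divide_pos_pos zero_less_numeral)
        have "dist z w \<le> dist z x + dist x y + dist w y"
          using dist_triangle[of z w x] dist_triangle[of x w y] by (simp add: dist_commute)
        then have "dist z w \<le> M + 1" using zw r True by simp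
        then obtain C where C: "connected C" "C \<subseteq> E" "C \<subseteq> cball z K" "z \<in> C" "w \<in> C"
          using K(2)[OF zw(1,2)] by blast
        obtain v N where v: "v 0 = z" "v N = w" "\<And>i. i \<le> N \<Longrightarrow> v i \<in> C"
          "\<And>i. i < N \<Longrightarrow> dist (v i) (v (Suc i)) \<le> r / 2"
          using chain_in_connected[OF C(1,4,5), of "r / 2"] r by auto
        \<comment> \<open>A finite chain in an open set admits a common radius.\<close>
        have "\<exists>e>0. \<forall>i\<le>N. ball (v i) e \<subseteq> E"
        proof -
          have "\<forall>i\<in>{..N}. \<exists>e>0. ball (v i) e \<subseteq> E"
            using v C opn by (meson atMost_iff open_contains_ball subsetD)
          then obtain e where e: "\<forall>i\<in>{..N}. e i > 0 \<and> ball (v i) (e i) \<subseteq> E" by metis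
          have "ball (v i) (Min (e ` {..N})) \<subseteq> E" if "i \<le> N" for i
          proof -
            have "ball (v i) (Min (e ` {..N})) \<subseteq> ball (v i) (e i)" using that by (intro subset_ball) simp
            then show ?thesis using e that by blast
          qed
          moreover have "Min (e ` {..N}) > 0" using e by simp
          ultimately show ?thesis by blast
        qed
        then obtain e where e: "e > 0" "\<And>i. i \<le> N \<Longrightarrow> ball (v i) e \<subseteq> E" by blast
        obtain n0 :: nat where n0: "r / 4 / e < real n0" using reals_Archimedean2 by blast
        \<comment> \<open>\<open>N\<close> makes room for the chain, and \<open>n0\<close> brings
          \<open>s n\<close> below the common radius \<open>e\<close>.\<close>
        define n where "n = max N n0"
        have "s n \<le> e"
        proof -
          have "r / 4 < e * real n0" using n0 e by (simp add: field_simps)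
          also have "\<dots> \<le> e * (real n + 1)" using e by (intro mult_left_mono) (auto simp: n_def)
          finally show ?thesis by (simp add: s_def field_simps)
        qed
        \<comment> \<open>The same chain serves all nearby pairs: moving an endpoint by
          \<open>r / 4\<close> adds to the \<open>r / 4\<close> between \<open>z\<close> and
          \<open>x\<close>, giving the allowed \<open>r / 2\<close>.\<close>
        have "P x' y' n" if xy: "x' \<in> ball x (r / 4)" "y' \<in> ball y (r / 4)" for x' y'
        proof -
          have d: "dist x' z \<le> r / 2" "dist y' w \<le> r / 2"
            using xy zw dist_triangle[of x' z x] dist_triangle[of y' w y] by (simp_all add: dist_commute)
          have "dist x' (v i) \<le> K + 1" if "i \<le> N" for i
          proof -
            have "dist z (v i) \<le> K" using v(3)[OF that] C(3) by auto
            then show ?thesis using d(1) r dist_triangle[of x' "v i" z] by simp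
          qed
          moreover have "ball (v (min i N)) (s n) \<subseteq> E" for i
            using e(2)[of "min i N"] subset_ball[OF \<open>s n \<le> e\<close>] by fastforce
          moreover have "dist (v (min i N)) (v (min (Suc i) N)) \<le> r / 2" for i
            using v(4)[of i] r by (cases "i < N") (auto simp: min_def)
          ultimately show ?thesis
            unfolding P_def using d v(1,2)
            by (intro impI exI[of _ "\<lambda>i. v (min i N)"]) (auto simp: n_def)
        qed
        moreover have "x \<in> ball x (r / 4)" "y \<in> ball y (r / 4)" using r by auto
        ultimately show ?thesis using open_ball by blast
      qed
    qed
    then obtain n where n: "\<And>x y. dist x y \<le> M \<Longrightarrow> P x y n" by blast
    have "\<exists>w. (\<forall>i\<le>n. ball (w i) (s n) \<subseteq> E \<inter> cball x (K + 2)) \<and>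
        (\<forall>i<n. \<forall>\<xi>\<in>ball (w i) (s n). \<forall>\<eta>\<in>ball (w (Suc i)) (s n). dist \<xi> \<eta> \<le> r) \<and>
        ball (w 0) (s n) \<subseteq> cball x r \<and> ball (w n) (s n) \<subseteq> cball y r"
      if xy: "x \<in> E" "y \<in> E" "dist x y \<le> M" for x y
    proof -
      obtain w where w: "\<And>i. i\<le>n \<Longrightarrow> ball (w i) (s n) \<subseteq> E \<and> dist x (w i) \<le> K + 1"
        "\<And>i. i<n \<Longrightarrow> dist (w i) (w (Suc i)) \<le> r / 2" "dist x (w 0) \<le> r / 2" "dist y (w n) \<le> r / 2"
        using n[OF xy(3)] xy closure_subset[of E] unfolding P_def by blast
      \<comment> \<open>Passing from centres to points of the balls costs at most
        \<open>r / 4\<close> per ball: consecutive balls lie within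
        \<open>r / 2 + r / 4 + r / 4 = r\<close>, and \<open>K + 1\<close> grows to at most
        \<open>K + 2\<close>.\<close>
      have near: "dist a \<xi> \<le> c + r / 4" if "\<xi> \<in> ball b (s n)" "dist a b \<le> c" for a b \<xi> c
        using that s(2)[of n] dist_triangle[of a \<xi> b] by simp
      have "ball (w i) (s n) \<subseteq> cball x (K + 2)" if "i \<le> n" for i
      proof
        fix \<xi> assume "\<xi> \<in> ball (w i) (s n)"
        from near[OF this, of x "K + 1"] w(1)[OF that] r show "\<xi> \<in> cball x (K + 2)" by simp
      qed
      moreover have "dist \<xi> \<eta> \<le> r" if "i < n" "\<xi> \<in> ball (w i) (s n)" "\<eta> \<in> ball (w (Suc i)) (s n)" for i \<xi> \<eta>
      proof -
        have "dist (w i) \<eta> \<le> r / 2 + r / 4" using near that w(2) by blast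
        moreover have "dist \<xi> (w i) \<le> r / 4" using that s(2)[of n] by (simp add: dist_commute)
        ultimately show ?thesis using dist_triangle[of \<xi> \<eta> "w i"] by simp
      qed
      moreover have "ball (w 0) (s n) \<subseteq> cball x r" "ball (w n) (s n) \<subseteq> cball y r"
        using near[OF _ w(3)] near[OF _ w(4)] r by (force simp del: mem_ball)+
      ultimately show ?thesis using w(1) by (intro exI[of _ w]) auto
    qed
    then show "\<exists>n \<sigma>. \<sigma> > 0 \<and> (\<forall>x\<in>E. \<forall>y\<in>E. dist x y \<le> M \<longrightarrow>
      (\<exists>w. (\<forall>i\<le>n. ball (w i) \<sigma> \<subseteq> E \<inter> cball x (K + 2)) \<and>
        (\<forall>i<n. \<forall>\<xi>\<in>ball (w i) \<sigma>. \<forall>\<eta>\<in>ball (w (Suc i)) \<sigma>. dist \<xi> \<eta> \<le> r) \<and>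
        ball (w 0) \<sigma> \<subseteq> cball x r \<and> ball (w n) \<sigma> \<subseteq> cball y r))"
      using s(1)[of n] by blast
  qed
qed

text \<open>For each \<open>x\<close> the vectors moving \<open>x\<close> into \<open>E\<close> form
  a nonempty open set, which meets a countable dense set. Each vector works on an open set of
  \<open>x\<close>, so compactness modulo integer translations leaves finitely many.\<close>

lemma covering_translations:
  assumes "E \<noteq> {}"
  shows "\<exists>(t :: nat \<Rightarrow> real ^ 'n) n. t 0 = 0 \<and> (\<forall>x. \<exists>j\<le>n. x + t j \<in> E)"
proof -
  obtain D :: "(real ^ 'n) set" where D: "countable D" "\<And>U. open U \<Longrightarrow> U \<noteq> {} \<Longrightarrow> \<exists>d\<in>D. d \<in> U"
    by (rule countable_dense_setE) blast
  \<comment> \<open>The zero vector comes first, so that taking the least admissible index later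
    fixes the points already in the set.\<close>
  define t where "t j = (case j of 0 \<Rightarrow> 0 | Suc i \<Rightarrow> from_nat_into D i)" for j
  have opn_j: "open {x. x + c \<in> E}" for c
  proof -
    have "open ((\<lambda>x. x + c) -` E)" by (intro open_vimage opn continuous_intros)
    then show ?thesis by (simp add: vimage_def)
  qed
  \<comment> \<open>The second point is a dummy: the uniformity lemma for pairs is used at distance
    0.\<close>
  define P where "P x (y :: real ^ 'n) n \<longleftrightarrow> (\<exists>j\<le>n. x + t j \<in> E)" for x y n
  have "\<exists>n. \<forall>x y. dist x y \<le> 0 \<longrightarrow> P x y n"
  proof (rule periodic_uniform[of P 0])
    show "P x y n" if "P x y m" "m \<le> n" for x y m n
      using that unfolding P_def by (meson le_trans)
    show "P (x + axis i 1) (y + axis i 1) n \<longleftrightarrow> P x y n" for x y n i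
    proof -
      have "x + axis i 1 + t j \<in> E \<longleftrightarrow> x + t j \<in> E" for j
      proof -
        have "x + axis i 1 + t j = (x + t j) + axis i 1" by simp
        then show ?thesis by (simp only: shift_iff)
      qed
      then show ?thesis by (simp add: P_def)
    qed
    show "\<exists>U V n. open U \<and> open V \<and> x \<in> U \<and> y \<in> V \<and> (\<forall>x'\<in>U. \<forall>y'\<in>V. P x' y' n)" for x y
    proof -
      obtain e where "e \<in> E" using assms by blast
      then have "e - x \<in> {d. d + x \<in> E}" by simp
      then have "\<exists>d\<in>D. d \<in> {d. d + x \<in> E}" by (intro D(2)[OF opn_j]) (use \<open>e - x \<in> _\<close> in blast)
      then obtain d where d: "d \<in> D" "d + x \<in> E" by blast
      then have "x + d \<in> E" by (simp add: add.commute)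
      obtain i where "from_nat_into D i = d" using from_nat_into_surj[OF D(1) d(1)] by (rule exE)
      then have "x + t (Suc i) \<in> E" using \<open>x + d \<in> E\<close> by (simp add: t_def)
      then show ?thesis using opn_j[of "t (Suc i)"]
        by (intro exI[of _ "{x. x + t (Suc i) \<in> E}"] exI[of _ UNIV] exI[of _ "Suc i"]) (auto simp: P_def)
    qed
  qed
  then obtain n where n: "\<And>x y. dist x y \<le> 0 \<Longrightarrow> P x y n" by blast
  have "\<exists>j\<le>n. x + t j \<in> E" for x using n[of x x] by (simp add: P_def)
  then show ?thesis by (intro exI[of _ t] exI[of _ n]) (simp add: t_def)
qed

end

section \<open>Nonlocal energies along chains\<close>

lemma sigma_finite_lebesgue: "sigma_finite_measure (lebesgue :: 'a::euclidean_space measure)"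
proof
  let ?A = "range (\<lambda>n::nat. cball (0 :: 'a) (real n))"
  have "\<Union>?A = UNIV" using real_arch_simple by (auto simp: mem_cball)
  moreover have "emeasure lebesgue (cball (0 :: 'a) r) \<noteq> \<infinity>" for r
    using emeasure_lborel_cball_finite[of 0 r] by (simp add: less_top)
  ultimately show "\<exists>A. countable A \<and> A \<subseteq> sets lebesgue \<and> \<Union> A = space lebesgue \<and>
      (\<forall>a\<in>A. emeasure (lebesgue :: 'a measure) a \<noteq> \<infinity>)"
    by (intro exI[of _ ?A]) auto
qed

lemma id_borel_measurable_lebesgue' [measurable]: "(\<lambda>x. x) \<in> borel_measurable lebesgue"
  by (rule measurable_completion) simp

lemma emeasure_lebesgue_ball:
  fixes c :: "'a::euclidean_space"
  assumes "0 \<le> r"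
  shows "emeasure lebesgue (ball c r) = ennreal (unit_ball_vol (real DIM('a)) * r ^ DIM('a))"
    and "emeasure lebesgue (cball c r) = ennreal (unit_ball_vol (real DIM('a)) * r ^ DIM('a))"
  using emeasure_ball[OF assms, of c] emeasure_cball[OF assms, of c] by simp_all

text \<open>A translation is the affine map with all scaling factors equal to 1, for which the
  density in the change of variables is 1.\<close>

lemma lebesgue_translation:
  fixes c :: "'a::euclidean_space"
  shows measurable_lebesgue_translation: "(\<lambda>x. x + c) \<in> lebesgue \<rightarrow>\<^sub>M lebesgue"
    and nn_integral_lebesgue_translation: "f \<in> borel_measurable lebesgue \<Longrightarrow>
      (\<integral>\<^sup>+x. f (x + c) \<partial>lebesgue) = (\<integral>\<^sup>+x. f x \<partial>lebesgue)"
proof -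
  have eq: "(\<lambda>x. c + (\<Sum>j\<in>Basis. (1 * (x \<bullet> j)) *\<^sub>R j)) = (\<lambda>x. x + c)"
    by (auto simp: euclidean_representation)
  show meas: "(\<lambda>x. x + c) \<in> lebesgue \<rightarrow>\<^sub>M lebesgue"
    using lebesgue_affine_measurable[of "\<lambda>_. 1" c] unfolding eq by simp
  have "lebesgue = density (distr lebesgue lebesgue (\<lambda>x. x + c)) (\<lambda>_. 1)"
    using lebesgue_affine_euclidean[of "\<lambda>_. 1" c] unfolding eq by simp
  then have distr: "distr lebesgue lebesgue (\<lambda>x. x + c) = lebesgue"
    by (simp add: density_1)
  assume f: "f \<in> borel_measurable lebesgue"
  show "(\<integral>\<^sup>+x. f (x + c) \<partial>lebesgue) = (\<integral>\<^sup>+x. f x \<partial>lebesgue)"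
    using nn_integral_distr[OF meas, of f] f by (simp add: distr)
qed

lemma measurable_dist_lebesgue [measurable]:
  "(\<lambda>z. dist (fst z) (snd z)) \<in> borel_measurable (lebesgue \<Otimes>\<^sub>M (lebesgue :: 'a::euclidean_space measure))"
proof -
  have [measurable]: "fst \<in> borel_measurable (lebesgue \<Otimes>\<^sub>M (lebesgue :: 'a measure))"
    by (rule measurable_compose[OF measurable_fst id_borel_measurable_lebesgue'])
  have [measurable]: "snd \<in> borel_measurable (lebesgue \<Otimes>\<^sub>M (lebesgue :: 'a measure))"
    by (rule measurable_compose[OF measurable_snd id_borel_measurable_lebesgue'])
  show ?thesis by measurable
qed

text \<open>Tonelli: every section of the set of pairs at distance at most \<open>a\<close>, in
  either variable, is a closed ball of the same volume \<open>b\<close>. The last two parts treat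
  integration over a moving ball as a function of its centre.\<close>

lemma nn_integral_near:
  fixes f :: "'a::euclidean_space \<Rightarrow> ennreal"
  assumes f [measurable]: "f \<in> borel_measurable lebesgue" and a: "a \<ge> 0"
  defines "b \<equiv> emeasure lebesgue (cball (0 :: 'a) a)"
  shows "(\<integral>\<^sup>+z. f (fst z) * indicator {z. dist (fst z) (snd z) \<le> a} z \<partial>(lebesgue \<Otimes>\<^sub>M lebesgue)) = b * integral\<^sup>N lebesgue f"
    and "(\<integral>\<^sup>+z. f (snd z) * indicator {z. dist (fst z) (snd z) \<le> a} z \<partial>(lebesgue \<Otimes>\<^sub>M lebesgue)) = b * integral\<^sup>N lebesgue f"
    and "(\<lambda>x. \<integral>\<^sup>+y\<in>cball x a. f y \<partial>lebesgue) \<in> borel_measurable lebesgue"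
    and "(\<integral>\<^sup>+x. (\<integral>\<^sup>+y\<in>cball x a. f y \<partial>lebesgue) \<partial>lebesgue) = b * integral\<^sup>N lebesgue f"
proof -
  interpret sigma_finite_measure "lebesgue :: 'a measure" by (rule sigma_finite_lebesgue)
  interpret P: pair_sigma_finite "lebesgue :: 'a measure" "lebesgue :: 'a measure" ..
  have b: "emeasure lebesgue (cball x a) = b" for x :: 'a
    unfolding b_def by (simp only: emeasure_lebesgue_ball[OF a])
  have ind: "indicator {z. dist (fst z) (snd z) \<le> a} (x, y) = (indicator (cball x a) y :: ennreal)"
    "indicator {z. dist (fst z) (snd z) \<le> a} (x, y) = (indicator (cball y a) x :: ennreal)" for x y :: 'a
    by (auto simp: dist_commute split: split_indicator)
  have [measurable]: "{z. dist (fst z) (snd z) \<le> a} \<in> sets (lebesgue \<Otimes>\<^sub>M (lebesgue :: 'a measure))"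
  proof -
    have "{z \<in> space (lebesgue \<Otimes>\<^sub>M (lebesgue :: 'a measure)). dist (fst z) (snd z) \<le> a} \<in> sets (lebesgue \<Otimes>\<^sub>M (lebesgue :: 'a measure))"
      by measurable
    then show ?thesis by (simp add: space_pair_measure)
  qed
  have c: "(\<integral>\<^sup>+y. f x * indicator (cball x a) y \<partial>lebesgue) = b * f x" for x
    by (subst nn_integral_cmult) (auto simp: b mult.commute intro!: borel_measurable_indicator)
  have m1: "(\<lambda>z. f (fst z) * indicator {z. dist (fst z) (snd z) \<le> a} z) \<in> borel_measurable (lebesgue \<Otimes>\<^sub>M lebesgue)"
    by measurable
  have m2: "(\<lambda>z. f (snd z) * indicator {z. dist (fst z) (snd z) \<le> a} z) \<in> borel_measurable (lebesgue \<Otimes>\<^sub>M lebesgue)"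
    by measurable
  show "(\<integral>\<^sup>+z. f (fst z) * indicator {z. dist (fst z) (snd z) \<le> a} z \<partial>(lebesgue \<Otimes>\<^sub>M lebesgue)) = b * integral\<^sup>N lebesgue f"
    using nn_integral_fst[OF m1] by (simp add: ind(1) c nn_integral_cmult)
  show snd: "(\<integral>\<^sup>+z. f (snd z) * indicator {z. dist (fst z) (snd z) \<le> a} z \<partial>(lebesgue \<Otimes>\<^sub>M lebesgue)) = b * integral\<^sup>N lebesgue f"
    using P.nn_integral_snd[OF m2] by (simp add: ind(2) c nn_integral_cmult)
  show "(\<lambda>x. \<integral>\<^sup>+y\<in>cball x a. f y \<partial>lebesgue) \<in> borel_measurable lebesgue"
    using borel_measurable_nn_integral_fst[OF m2] by (simp add: ind(1))
  show "(\<integral>\<^sup>+x. (\<integral>\<^sup>+y\<in>cball x a. f y \<partial>lebesgue) \<partial>lebesgue) = b * integral\<^sup>N lebesgue f"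
    using nn_integral_fst[OF m2] snd by (simp add: ind(1))
qed

section \<open>Increment energies\<close>

definition increment :: "real \<Rightarrow> real \<Rightarrow> 'a::metric_space set \<Rightarrow> ('a \<Rightarrow> real) \<Rightarrow> 'a \<Rightarrow> 'a \<Rightarrow> ennreal" where
  "increment p \<rho> S u x y = (if x \<in> S \<and> y \<in> S \<and> dist x y \<le> \<rho> then ennreal (\<bar>u x - u y\<bar> powr p) else 0)"

text \<open>The inner integral of the nonlocal energy: its integral over the space is the double
  integral over pairs in \<open>S\<close> at distance at most \<rho>.\<close>

definition local_energy :: "real \<Rightarrow> real \<Rightarrow> 'a::euclidean_space set \<Rightarrow> ('a \<Rightarrow> real) \<Rightarrow> 'a \<Rightarrow> ennreal" where
  "local_energy p \<rho> S u x = (\<integral>\<^sup>+y. increment p \<rho> S u x y \<partial>lebesgue)"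

lemma measurable_increment [measurable]:
  fixes S :: "'a::euclidean_space set"
  assumes [measurable]: "u \<in> borel_measurable lebesgue" "S \<in> sets lebesgue"
  shows "(\<lambda>z. increment p \<rho> S u (fst z) (snd z)) \<in> borel_measurable (lebesgue \<Otimes>\<^sub>M lebesgue)"
  unfolding increment_def by measurable

lemma measurable_increment_right [measurable]:
  fixes S :: "'a::euclidean_space set"
  assumes [measurable]: "u \<in> borel_measurable lebesgue" "S \<in> sets lebesgue"
  shows "increment p \<rho> S u x \<in> borel_measurable lebesgue"
  using measurable_compose[OF measurable_Pair1'[of x lebesgue lebesgue] measurable_increment[OF assms, of p \<rho>]] by simp

lemma measurable_local_energy [measurable]:
  fixes S :: "'a::euclidean_space set"
  assumes "u \<in> borel_measurable lebesgue" "S \<in> sets lebesgue"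
  shows "local_energy p \<rho> S u \<in> borel_measurable lebesgue"
proof -
  interpret sigma_finite_measure "lebesgue :: 'a measure" by (rule sigma_finite_lebesgue)
  show ?thesis
    using borel_measurable_nn_integral_fst[OF measurable_increment[OF assms, of p \<rho>]]
    by (simp add: local_energy_def[abs_def])
qed

lemma nn_integral_local_energy:
  fixes S :: "(real ^ 'n) set"
  assumes "u \<in> borel_measurable lebesgue" "S \<in> sets lebesgue"
  shows "(\<integral>\<^sup>+x. local_energy p \<rho> S u x \<partial>lebesgue) =
    (\<integral>\<^sup>+z \<in> (S \<times> S) \<inter> strip \<rho>. ennreal (\<bar>u (fst z) - u (snd z)\<bar> powr p) \<partial>(lebesgue \<Otimes>\<^sub>M lebesgue))"
proof -
  interpret sigma_finite_measure "lebesgue :: (real ^ 'n) measure" by (rule sigma_finite_lebesgue)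
  have "(\<integral>\<^sup>+x. local_energy p \<rho> S u x \<partial>lebesgue) =
      (\<integral>\<^sup>+z. increment p \<rho> S u (fst z) (snd z) \<partial>(lebesgue \<Otimes>\<^sub>M lebesgue))"
    using nn_integral_fst[OF measurable_increment[OF assms, of p \<rho>]] by (simp add: local_energy_def)
  also have "\<dots> = (\<integral>\<^sup>+z \<in> (S \<times> S) \<inter> strip \<rho>. ennreal (\<bar>u (fst z) - u (snd z)\<bar> powr p) \<partial>(lebesgue \<Otimes>\<^sub>M lebesgue))"
    by (intro nn_integral_cong) (auto simp: increment_def strip_def dist_norm split: split_indicator)
  finally show ?thesis .
qed

text \<open>From \<open>\<bar>a + b\<bar> \<le> 2 * max \<bar>a\<bar> \<bar>b\<bar>\<close> and
  monotonicity of the power; the maximum of the powers is at most their sum.\<close>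

lemma powr_add_le:
  assumes "p > (0 :: real)"
  shows "\<bar>a + b\<bar> powr p \<le> 2 powr p * (\<bar>a\<bar> powr p + \<bar>b\<bar> powr p)"
proof -
  have "\<bar>a + b\<bar> powr p \<le> (2 * max \<bar>a\<bar> \<bar>b\<bar>) powr p"
    using assms by (intro powr_mono2) (auto simp: max_def)
  also have "\<dots> = 2 powr p * max (\<bar>a\<bar> powr p) (\<bar>b\<bar> powr p)"
    by (auto simp: powr_mult max_def) (use assms powr_mono2[of p "\<bar>a\<bar>" "\<bar>b\<bar>"] powr_mono2[of p "\<bar>b\<bar>" "\<bar>a\<bar>"] in fastforce)+
  also have "\<dots> \<le> 2 powr p * (\<bar>a\<bar> powr p + \<bar>b\<bar> powr p)"
    by (intro mult_left_mono) auto
  finally show ?thesis .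
qed

lemma ennreal_powr_triangle:
  assumes "p > (0 :: real)"
  shows "ennreal (\<bar>a - c\<bar> powr p) \<le>
    ennreal (2 powr p) * (ennreal (\<bar>a - b\<bar> powr p) + ennreal (\<bar>b - c\<bar> powr p))"
  using powr_add_le[OF assms, of "a - b" "b - c"]
  by (simp flip: ennreal_plus ennreal_mult add: ennreal_leI)

text \<open>Let \<open>I i\<close> be the integral of
  \<open>\<bar>u x - u \<xi>\<bar> powr p\<close> over the ball \<open>i\<close>. Inserting an
  intermediate point of the previous ball and integrating over it bounds
  \<open>\<beta> * I (Suc i)\<close> by \<open>D * (\<beta> * I i + G)\<close>. The term
  \<open>G\<close> integrates the local energy over all of \<open>cball x L\<close>, so the final
  bound does not see where the balls lie. Multiplying by the volume \<beta> replaces averaging and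
  avoids division.\<close>

lemma chain_estimate:
  fixes w :: "nat \<Rightarrow> 'a::euclidean_space"
  assumes u [measurable]: "u \<in> borel_measurable lebesgue" and S [measurable]: "S \<in> sets lebesgue"
    and p: "p > 0" and s: "s \<ge> 0" and xy: "x \<in> S" "y \<in> S"
    and sub: "\<And>i. i \<le> n \<Longrightarrow> ball (w i) s \<subseteq> S \<inter> cball x L"
    and step: "\<And>i \<xi> \<eta>. i < n \<Longrightarrow> \<xi> \<in> ball (w i) s \<Longrightarrow> \<eta> \<in> ball (w (Suc i)) s \<Longrightarrow> dist \<xi> \<eta> \<le> \<rho>"
    and start: "ball (w 0) s \<subseteq> cball x \<rho>" and finish: "ball (w n) s \<subseteq> cball y \<rho>"
  defines "\<beta> \<equiv> emeasure lebesgue (ball (0 :: 'a) s)" and "D \<equiv> ennreal (2 powr p)"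
    and "g \<equiv> local_energy p \<rho> S u"
  shows "\<beta> * \<beta> * ennreal (\<bar>u x - u y\<bar> powr p) \<le>
    D * (2 * D) ^ n * (\<beta> * g x + (\<integral>\<^sup>+\<xi>\<in>cball x L. g \<xi> \<partial>lebesgue) + \<beta> * g y)"
proof -
  define k where "k \<xi> = ennreal (\<bar>u x - u \<xi>\<bar> powr p)" for \<xi>
  define I where "I i = (\<integral>\<^sup>+\<xi>\<in>ball (w i) s. k \<xi> \<partial>lebesgue)" for i
  define G where "G = (\<integral>\<^sup>+\<xi>\<in>cball x L. g \<xi> \<partial>lebesgue)"
  have [measurable]: "k \<in> borel_measurable lebesgue" unfolding k_def by measurable
  have [measurable]: "g \<in> borel_measurable lebesgue" unfolding g_def by measurable
  have [measurable]: "ball c s \<in> sets lebesgue" "cball c L \<in> sets lebesgue" for c :: 'a by auto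
  have \<beta>: "emeasure lebesgue (ball c s) = \<beta>" for c :: 'a
    unfolding \<beta>_def by (simp only: emeasure_lebesgue_ball[OF s])
  have D1: "1 \<le> D" using p by (simp add: D_def ge_one_powr_ge_zero)
  have const: "(\<integral>\<^sup>+\<xi>. c * indicator (ball (w i) s) \<xi> \<partial>lebesgue) = c * \<beta>" for c i
    by (subst nn_integral_cmult) (auto simp: \<beta> intro!: borel_measurable_indicator)
  \<comment> \<open>The first ball lies in \<open>S\<close> within \<rho> of \<open>x\<close>, so
    its integral is part of the local energy at \<open>x\<close>.\<close>
  have I0: "I 0 \<le> g x"
    unfolding I_def g_def local_energy_def
    using sub[of 0] start xy
    by (intro nn_integral_mono) (auto simp: increment_def k_def split: split_indicator)
  have I_Suc: "\<beta> * I (Suc i) \<le> D * (\<beta> * I i + G)" if i: "i < n" for i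
  proof -
    \<comment> \<open>For fixed \<xi> in ball \<open>i\<close>, every point of the next ball is
      within \<rho> of \<xi>, so the second half of the triangle inequality integrates to at most
      \<open>g \<xi>\<close>.\<close>
    have pt: "I (Suc i) * indicator (ball (w i) s) \<xi> \<le>
        D * (\<beta> * (k \<xi> * indicator (ball (w i) s) \<xi>) + g \<xi> * indicator (cball x L) \<xi>)" for \<xi>
    proof (cases "\<xi> \<in> ball (w i) s")
      case True
      then have \<xi>: "\<xi> \<in> S" "\<xi> \<in> cball x L" using sub[of i] i by auto
      have "I (Suc i) \<le> (\<integral>\<^sup>+\<eta>. D * (k \<xi> * indicator (ball (w (Suc i)) s) \<eta> + increment p \<rho> S u \<xi> \<eta>) \<partial>lebesgue)"
        unfolding I_def
      proof (intro nn_integral_mono)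
        fix \<eta>
        show "k \<eta> * indicator (ball (w (Suc i)) s) \<eta> \<le>
            D * (k \<xi> * indicator (ball (w (Suc i)) s) \<eta> + increment p \<rho> S u \<xi> \<eta>)"
        proof (cases "\<eta> \<in> ball (w (Suc i)) s")
          case \<eta>: True
          then have "\<eta> \<in> S" "dist \<xi> \<eta> \<le> \<rho>" using sub[of "Suc i"] i step[OF i True] by auto
          then show ?thesis
            using \<xi> \<eta> ennreal_powr_triangle[OF p, of "u x" "u \<eta>" "u \<xi>"] by (simp add: k_def increment_def D_def)
        qed simp
      qed
      also have "\<dots> = D * (k \<xi> * \<beta> + g \<xi>)"
        by (simp add: nn_integral_cmult nn_integral_add const g_def local_energy_def)
      finally show ?thesis using True \<xi> by (simp add: mult.commute)
    qed simp
    have "\<beta> * I (Suc i) = (\<integral>\<^sup>+\<xi>. I (Suc i) * indicator (ball (w i) s) \<xi> \<partial>lebesgue)"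
      by (simp add: const mult.commute)
    also have "\<dots> \<le> (\<integral>\<^sup>+\<xi>. D * (\<beta> * (k \<xi> * indicator (ball (w i) s) \<xi>) + g \<xi> * indicator (cball x L) \<xi>) \<partial>lebesgue)"
      by (intro nn_integral_mono pt)
    also have "\<dots> = D * (\<beta> * I i + G)"
      by (simp add: nn_integral_cmult nn_integral_add I_def G_def)
    finally show ?thesis .
  qed
  have I: "\<beta> * I i \<le> (2 * D) ^ i * (\<beta> * g x + G)" if "i \<le> n" for i
    using that
  proof (induction i)
    case 0
    have "\<beta> * I 0 \<le> \<beta> * g x" by (intro mult_left_mono I0) auto
    then show ?case by (simp add: add_increasing2)
  next
    case (Suc i)
    \<comment> \<open>Since the power is at least 1, \<open>G\<close> is bounded by the inductive
      bound itself; the resulting doubling explains the factor \<open>2 * D\<close> per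
      step.\<close>
    have "1 \<le> (2 * D) ^ i" using D1 by (intro one_le_power) (metis mult_2 add_increasing2 order_trans zero_le)
    then have "G \<le> (2 * D) ^ i * (\<beta> * g x + G)"
      using mult_mono[of 1 "(2 * D) ^ i" G "\<beta> * g x + G"] by (simp add: add_increasing)
    then have "D * (\<beta> * I i + G) \<le> D * ((2 * D) ^ i * (\<beta> * g x + G) + (2 * D) ^ i * (\<beta> * g x + G))"
      using Suc by (intro mult_left_mono add_mono) auto
    also have "\<dots> = (2 * D) ^ Suc i * (\<beta> * g x + G)"
      by (simp add: mult_2[symmetric] mult.assoc mult.left_commute)
    finally show ?case using I_Suc[of i] Suc by (meson Suc_le_lessD order_trans)
  qed
  \<comment> \<open>The constant \<open>k y\<close> is integrated over the last ball and compared
    there with \<open>k \<xi>\<close>; the error is at most the local energy at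
    \<open>y\<close>.\<close>
  have "\<beta> * ennreal (\<bar>u x - u y\<bar> powr p) = (\<integral>\<^sup>+\<xi>. k y * indicator (ball (w n) s) \<xi> \<partial>lebesgue)"
    by (subst const) (simp add: k_def mult.commute)
  also have "\<dots> \<le> (\<integral>\<^sup>+\<xi>. D * (k \<xi> * indicator (ball (w n) s) \<xi> + increment p \<rho> S u y \<xi>) \<partial>lebesgue)"
  proof (intro nn_integral_mono)
    fix \<xi>
    show "k y * indicator (ball (w n) s) \<xi> \<le> D * (k \<xi> * indicator (ball (w n) s) \<xi> + increment p \<rho> S u y \<xi>)"
    proof (cases "\<xi> \<in> ball (w n) s")
      case True
      then have "\<xi> \<in> S" "dist y \<xi> \<le> \<rho>" using sub[of n] finish by auto
      then show ?thesis
        using True xy ennreal_powr_triangle[OF p, of "u x" "u y" "u \<xi>"]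
        by (simp add: k_def increment_def D_def abs_minus_commute)
    qed simp
  qed
  also have "\<dots> = D * (I n + g y)"
    by (simp add: nn_integral_cmult nn_integral_add I_def g_def local_energy_def)
  finally have "\<beta> * \<beta> * ennreal (\<bar>u x - u y\<bar> powr p) \<le> \<beta> * (D * (I n + g y))"
    by (simp add: mult.assoc mult_left_mono)
  also have "\<dots> = D * (\<beta> * I n + \<beta> * g y)"
    by (simp add: distrib_left mult.left_commute)
  also have "\<dots> \<le> D * ((2 * D) ^ n * (\<beta> * g x + G) + (2 * D) ^ n * (\<beta> * g y))"
  proof (intro mult_left_mono add_mono I)
    have "1 \<le> (2 * D) ^ n" using D1 by (intro one_le_power) (metis mult_2 add_increasing2 order_trans zero_le)
    then show "\<beta> * g y \<le> (2 * D) ^ n * (\<beta> * g y)"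
      using mult_right_mono[of 1 "(2 * D) ^ n" "\<beta> * g y"] by simp
  qed auto
  finally show ?thesis unfolding G_def by (simp add: distrib_left mult.assoc)
qed

text \<open>Each term on the right of \<open>est\<close> depends on one point of the pair only.
  Integrating out the other point gives the volume of a ball of radius \<open>a\<close>, removing
  \<psi> costs the factor \<open>m\<close>, and integrating the local energy over moving balls costs
  the volume of a ball of radius \<open>L\<close>.\<close>

lemma integrate_chain_estimate:
  fixes V S :: "(real ^ 'n) set"
  assumes u [measurable]: "u \<in> borel_measurable lebesgue" and S [measurable]: "S \<in> sets lebesgue"
    and v [measurable]: "v \<in> borel_measurable lebesgue" and V [measurable]: "V \<in> sets lebesgue"
    and \<psi> [measurable]: "\<psi> \<in> lebesgue \<rightarrow>\<^sub>M lebesgue"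
    and push: "\<And>f. f \<in> borel_measurable lebesgue \<Longrightarrow>
      (\<integral>\<^sup>+x. f (\<psi> x) \<partial>lebesgue) \<le> m * (\<integral>\<^sup>+x. f x \<partial>lebesgue)"
    and a: "a \<ge> 0" and L: "L \<ge> 0"
    and est: "\<And>x y. x \<in> V \<Longrightarrow> y \<in> V \<Longrightarrow> dist x y \<le> a \<Longrightarrow>
      \<beta> * \<beta> * ennreal (\<bar>v x - v y\<bar> powr p) \<le> A * (\<beta> * local_energy p \<rho> S u (\<psi> x) +
        (\<integral>\<^sup>+\<xi>\<in>cball (\<psi> x) L. local_energy p \<rho> S u \<xi> \<partial>lebesgue) + \<beta> * local_energy p \<rho> S u (\<psi> y))"
  shows "\<beta> * \<beta> * (\<integral>\<^sup>+z \<in> (V \<times> V) \<inter> strip a. ennreal (\<bar>v (fst z) - v (snd z)\<bar> powr p) \<partial>(lebesgue \<Otimes>\<^sub>M lebesgue))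
    \<le> A * (emeasure lebesgue (cball (0 :: real ^ 'n) a) * m * (2 * \<beta> + emeasure lebesgue (cball (0 :: real ^ 'n) L)) *
      (\<integral>\<^sup>+z \<in> (S \<times> S) \<inter> strip \<rho>. ennreal (\<bar>u (fst z) - u (snd z)\<bar> powr p) \<partial>(lebesgue \<Otimes>\<^sub>M lebesgue)))"
proof -
  define g where "g = local_energy p \<rho> S u"
  define G where "G x = (\<integral>\<^sup>+\<xi>\<in>cball x L. g \<xi> \<partial>lebesgue)" for x
  define N where "N = {z :: (real ^ 'n) \<times> (real ^ 'n). dist (fst z) (snd z) \<le> a}"
  define b where "b = emeasure lebesgue (cball (0 :: real ^ 'n) a)"
  define l where "l = emeasure lebesgue (cball (0 :: real ^ 'n) L)"
  have g [measurable]: "g \<in> borel_measurable lebesgue" unfolding g_def by measurable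
  have G [measurable]: "G \<in> borel_measurable lebesgue"
    unfolding G_def by (rule nn_integral_near(3)[OF g L])
  have intG: "integral\<^sup>N lebesgue G = l * integral\<^sup>N lebesgue g"
    unfolding G_def l_def by (rule nn_integral_near(4)[OF g L])
  have g\<psi> [measurable]: "(\<lambda>x. g (\<psi> x)) \<in> borel_measurable lebesgue" by measurable
  have G\<psi> [measurable]: "(\<lambda>x. G (\<psi> x)) \<in> borel_measurable lebesgue" by measurable
  have N [measurable]: "N \<in> sets (lebesgue \<Otimes>\<^sub>M (lebesgue :: (real ^ 'n) measure))"
  proof -
    have "{z \<in> space (lebesgue \<Otimes>\<^sub>M (lebesgue :: (real ^ 'n) measure)). dist (fst z) (snd z) \<le> a} \<in> sets (lebesgue \<Otimes>\<^sub>M (lebesgue :: (real ^ 'n) measure))"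
      by measurable
    then show ?thesis by (simp add: space_pair_measure N_def)
  qed
  have strip: "strip a = N" by (auto simp: strip_def N_def dist_norm)
  have [measurable]: "V \<times> V \<inter> strip a \<in> sets (lebesgue \<Otimes>\<^sub>M lebesgue)" unfolding strip by measurable
  have "\<beta> * \<beta> * (\<integral>\<^sup>+z \<in> (V \<times> V) \<inter> strip a. ennreal (\<bar>v (fst z) - v (snd z)\<bar> powr p) \<partial>(lebesgue \<Otimes>\<^sub>M lebesgue))
      = (\<integral>\<^sup>+z. \<beta> * \<beta> * (ennreal (\<bar>v (fst z) - v (snd z)\<bar> powr p) * indicator ((V \<times> V) \<inter> strip a) z) \<partial>(lebesgue \<Otimes>\<^sub>M lebesgue))"
    by (subst nn_integral_cmult) auto
  \<comment> \<open>On the right the pairs are no longer confined to \<open>V\<close>; only the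
    closeness \<open>N\<close> remains, so that the near-diagonal integrals apply.\<close>
  also have "\<dots> \<le> (\<integral>\<^sup>+z. A * (\<beta> * (g (\<psi> (fst z)) * indicator N z) + G (\<psi> (fst z)) * indicator N z +
      \<beta> * (g (\<psi> (snd z)) * indicator N z)) \<partial>(lebesgue \<Otimes>\<^sub>M lebesgue))"
  proof (intro nn_integral_mono)
    fix z :: "(real ^ 'n) \<times> (real ^ 'n)"
    show "\<beta> * \<beta> * (ennreal (\<bar>v (fst z) - v (snd z)\<bar> powr p) * indicator ((V \<times> V) \<inter> strip a) z) \<le>
      A * (\<beta> * (g (\<psi> (fst z)) * indicator N z) + G (\<psi> (fst z)) * indicator N z +
      \<beta> * (g (\<psi> (snd z)) * indicator N z))"
    proof (cases "z \<in> (V \<times> V) \<inter> strip a")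
      case True
      then show ?thesis using est[of "fst z" "snd z"] unfolding strip
        by (auto simp: N_def g_def G_def)
    qed simp
  qed
  also have "\<dots> = A * (\<beta> * (b * (\<integral>\<^sup>+x. g (\<psi> x) \<partial>lebesgue)) + b * (\<integral>\<^sup>+x. G (\<psi> x) \<partial>lebesgue) +
      \<beta> * (b * (\<integral>\<^sup>+x. g (\<psi> x) \<partial>lebesgue)))"
    using nn_integral_near(1,2)[OF g\<psi> a] nn_integral_near(1)[OF G\<psi> a]
    by (simp add: nn_integral_cmult nn_integral_add N_def[symmetric] b_def[symmetric])
  also have "\<dots> \<le> A * (\<beta> * (b * (m * integral\<^sup>N lebesgue g)) + b * (m * (l * integral\<^sup>N lebesgue g)) +
      \<beta> * (b * (m * integral\<^sup>N lebesgue g)))"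
    using push[OF g] push[OF G] intG by (intro mult_left_mono add_mono) auto
  also have "\<dots> = A * (b * m * (2 * \<beta> + l) * integral\<^sup>N lebesgue g)"
    by (simp add: algebra_simps mult_2)
  finally show ?thesis
    unfolding b_def l_def g_def nn_integral_local_energy[OF u S] .
qed

section \<open>The extension operator\<close>

lemma open_inner_set: "open \<Omega> \<Longrightarrow> open (inner_set \<Omega> t)"
proof -
  assume "open \<Omega>"
  moreover have "open {x. infdist x (frontier \<Omega>) > t}"
    by (intro open_Collect_less continuous_intros)
  moreover have "inner_set \<Omega> t = \<Omega> \<inter> {x. infdist x (frontier \<Omega>) > t}"
    by (auto simp: inner_set_def)
  ultimately show ?thesis by (simp add: open_Int)
qed

text \<open>A connected ball meeting both \<Omega> and its complement would meet the frontier, at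
  distance at most \<open>t\<close> from its centre.\<close>

lemma cball_subset_of_inner_set:
  assumes "x \<in> inner_set \<Omega> t" and "t \<ge> 0"
  shows "cball x t \<subseteq> \<Omega>"
proof (rule ccontr)
  assume "\<not> cball x t \<subseteq> \<Omega>"
  then have "cball x t - \<Omega> \<noteq> {}" by blast
  moreover have "x \<in> cball x t \<inter> \<Omega>" using assms by (simp add: inner_set_def)
  ultimately obtain z where "z \<in> cball x t" "z \<in> frontier \<Omega>"
    using connected_Int_frontier[of "cball x t" \<Omega>] convex_connected[OF convex_cball] by blast
  then have "infdist x (frontier \<Omega>) \<le> t" using infdist_le[of z "frontier \<Omega>" x] by simp
  then show False using assms by (simp add: inner_set_def)
qed

lemma dist_scaled:
  fixes x y :: "'a::real_normed_vector"
  assumes "\<epsilon> > 0"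
  shows "dist (\<epsilon> *\<^sub>R x) (\<epsilon> *\<^sub>R y) = \<epsilon> * dist x y"
  using assms by (simp add: dist_norm flip: scaleR_right_diff_distrib)

text \<open>The map \<open>\<psi>\<close> is piecewise one of finitely many translations; hence the bound for the
  push-forward of Lebesgue measure.\<close>

lemma (in periodic_domain) retraction:
  assumes "E \<noteq> {}"
  shows "\<exists>\<tau> m :: real. \<tau> > 0 \<and> m > 0 \<and> (\<forall>\<epsilon>>0. \<exists>\<psi>. \<psi> \<in> lebesgue \<rightarrow>\<^sub>M lebesgue \<and> (\<forall>x. \<psi> x \<in> (*\<^sub>R) \<epsilon> ` E \<and> dist x (\<psi> x) \<le> \<epsilon> * \<tau>) \<and>
      (\<forall>x \<in> (*\<^sub>R) \<epsilon> ` E. \<psi> x = x) \<and>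
      (\<forall>f\<in>borel_measurable lebesgue. (\<integral>\<^sup>+x. f (\<psi> x) \<partial>lebesgue) \<le> ennreal m * (\<integral>\<^sup>+x. f x \<partial>lebesgue)))"
proof -
  obtain t :: "nat \<Rightarrow> real ^ 'n" and n where t: "t 0 = 0" "\<forall>x. \<exists>j\<le>n. x + t j \<in> E"
    using covering_translations[OF assms] by auto
  \<comment> \<open>The sum bounds every translation length; the summand 1 ensures
    positivity.\<close>
  define \<tau> where "\<tau> = 1 + (\<Sum>j\<le>n. norm (t j))"
  have \<tau>: "norm (t j) \<le> \<tau>" if "j \<le> n" for j
    unfolding \<tau>_def using that member_le_sum[of j "{..n}" "\<lambda>j. norm (t j)"] by simp
  show ?thesis
  proof (rule exI[of _ \<tau>], rule exI[of _ "real n + 1"], intro conjI allI impI)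
    show "\<tau> > 0" unfolding \<tau>_def by (simp add: add_pos_nonneg sum_nonneg)
    fix \<epsilon> :: real assume \<epsilon>: "\<epsilon> > 0"
    define F where "F = (*\<^sub>R) \<epsilon> ` E"
    have "open F" unfolding F_def using \<epsilon> opn by (intro open_scaling) auto
    then have [measurable]: "F \<in> sets lebesgue" by (simp add: lborelD)
    \<comment> \<open>The least index makes the choice canonical and measurable, and equals 0 on
      \<open>F\<close> because \<open>t 0 = 0\<close>.\<close>
    define k where "k x = (LEAST j. x + \<epsilon> *\<^sub>R t j \<in> F)" for x
    define \<psi> where "\<psi> x = x + \<epsilon> *\<^sub>R t (k x)" for x
    have ex: "\<exists>j\<le>n. x + \<epsilon> *\<^sub>R t j \<in> F" for x
    proof -
      obtain j where j: "j \<le> n" "(1 / \<epsilon>) *\<^sub>R x + t j \<in> E" using t by blast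
      then have "\<epsilon> *\<^sub>R ((1 / \<epsilon>) *\<^sub>R x + t j) \<in> F" unfolding F_def by blast
      then show ?thesis using j \<epsilon> by (auto simp: scaleR_add_right)
    qed
    have k: "x + \<epsilon> *\<^sub>R t (k x) \<in> F" "k x \<le> n" for x
    proof -
      obtain j where j: "j \<le> n" "x + \<epsilon> *\<^sub>R t j \<in> F" using ex by blast
      show "x + \<epsilon> *\<^sub>R t (k x) \<in> F" unfolding k_def by (rule LeastI[where P = "\<lambda>j. x + \<epsilon> *\<^sub>R t j \<in> F", OF j(2)])
      have "k x \<le> j" unfolding k_def by (rule Least_le[where P = "\<lambda>j. x + \<epsilon> *\<^sub>R t j \<in> F", OF j(2)])
      then show "k x \<le> n" using j(1) by simp
    qed
    have [measurable]: "(\<lambda>x. x + c) \<in> lebesgue \<rightarrow>\<^sub>M lebesgue" for c :: "real ^ 'n"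
      by (rule measurable_lebesgue_translation)
    have km: "k \<in> measurable lebesgue (count_space UNIV)" unfolding k_def by measurable
    have "\<psi> \<in> lebesgue \<rightarrow>\<^sub>M lebesgue"
      unfolding \<psi>_def by (rule measurable_compose_countable[OF _ km]) measurable
    moreover have "dist x (\<psi> x) \<le> \<epsilon> * \<tau>" for x
      using \<epsilon> \<tau>[OF k(2)] by (simp add: \<psi>_def dist_norm)
    moreover have "\<psi> x = x" if "x \<in> F" for x
      using that t(1) by (simp add: \<psi>_def k_def Least_equality[of _ 0])
    moreover have "(\<integral>\<^sup>+x. f (\<psi> x) \<partial>lebesgue) \<le> ennreal (real n + 1) * (\<integral>\<^sup>+x. f x \<partial>lebesgue)"
      if [measurable]: "f \<in> borel_measurable lebesgue" for f :: "real ^ 'n \<Rightarrow> ennreal"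
    proof -
      \<comment> \<open>At each point the value is one of the \<open>n + 1\<close> translates and
        hence below their sum; all translates have the same integral.\<close>
      have "(\<integral>\<^sup>+x. f (\<psi> x) \<partial>lebesgue) \<le> (\<integral>\<^sup>+x. (\<Sum>j\<le>n. f (x + \<epsilon> *\<^sub>R t j)) \<partial>lebesgue)"
        unfolding \<psi>_def using k(2) by (intro nn_integral_mono member_le_sum) auto
      also have "\<dots> = (\<Sum>j\<le>n. \<integral>\<^sup>+x. f x \<partial>lebesgue)"
        by (subst nn_integral_sum) (auto simp: nn_integral_lebesgue_translation)
      also have "\<dots> = ennreal (real n + 1) * (\<integral>\<^sup>+x. f x \<partial>lebesgue)"
        by (simp add: ennreal_of_nat_eq_real_of_nat add.commute)
      finally show ?thesis .
    qed
    ultimately show "\<exists>\<psi>. \<psi> \<in> lebesgue \<rightarrow>\<^sub>M lebesgue \<and> (\<forall>x. \<psi> x \<in> (*\<^sub>R) \<epsilon> ` E \<and> dist x (\<psi> x) \<le> \<epsilon> * \<tau>) \<and>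
      (\<forall>x \<in> (*\<^sub>R) \<epsilon> ` E. \<psi> x = x) \<and>
      (\<forall>f\<in>borel_measurable lebesgue. (\<integral>\<^sup>+x. f (\<psi> x) \<partial>lebesgue) \<le> ennreal (real n + 1) * (\<integral>\<^sup>+x. f x \<partial>lebesgue))"
      using k(1) unfolding F_def \<psi>_def[symmetric] by (intro exI[of _ \<psi>]) blast
  qed simp
qed

text \<open>The chains in \<open>E\<close> are scaled by \<epsilon>. The margin
  \<open>\<epsilon> * (\<tau> + K)\<close> around \<open>V\<close> leaves room for the displacement
  by \<psi> and then for the chain, so everything stays in \<Omega>. The volumes contribute the same
  power of \<epsilon> on both sides, so the constant is free of \<epsilon>.\<close>

lemma retraction_energy:
  fixes E \<Omega> V :: "(real ^ 'n) set" and \<tau> m \<sigma> K r \<epsilon> p :: real and n :: nat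
  defines "S \<equiv> \<Omega> \<inter> (*\<^sub>R) \<epsilon> ` E"
  assumes chain: "\<And>x y. x \<in> E \<Longrightarrow> y \<in> E \<Longrightarrow> dist x y \<le> 1 + 2 * \<tau> \<Longrightarrow>
      \<exists>w. (\<forall>i\<le>n. ball (w i) \<sigma> \<subseteq> E \<inter> cball x K) \<and>
        (\<forall>i<n. \<forall>\<xi>\<in>ball (w i) \<sigma>. \<forall>\<eta>\<in>ball (w (Suc i)) \<sigma>. dist \<xi> \<eta> \<le> r) \<and>
        ball (w 0) \<sigma> \<subseteq> cball x r \<and> ball (w n) \<sigma> \<subseteq> cball y r"
    and pos: "\<epsilon> > 0" "\<sigma> > 0" "\<tau> > 0" "K > 0" "m > 0" "p > 0"
    and \<psi>: "\<psi> \<in> lebesgue \<rightarrow>\<^sub>M lebesgue" "\<And>x. \<psi> x \<in> (*\<^sub>R) \<epsilon> ` E" "\<And>x. dist x (\<psi> x) \<le> \<epsilon> * \<tau>"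
      "\<And>f. f \<in> borel_measurable lebesgue \<Longrightarrow>
        (\<integral>\<^sup>+x. f (\<psi> x) \<partial>lebesgue) \<le> ennreal m * (\<integral>\<^sup>+x. f x \<partial>lebesgue)"
    and u: "u \<in> borel_measurable lebesgue" and S: "S \<in> sets lebesgue"
    and V: "V \<in> sets lebesgue" "\<And>x. x \<in> V \<Longrightarrow> cball x (\<epsilon> * (\<tau> + K)) \<subseteq> \<Omega>"
  shows "(\<integral>\<^sup>+z \<in> (V \<times> V) \<inter> strip \<epsilon>. ennreal (\<bar>u (\<psi> (fst z)) - u (\<psi> (snd z))\<bar> powr p) \<partial>(lebesgue \<Otimes>\<^sub>M lebesgue))
    \<le> ennreal (2 powr p * (2 * 2 powr p) ^ n * m * (2 * \<sigma> ^ CARD('n) + K ^ CARD('n)) / (\<sigma> ^ CARD('n))\<^sup>2) *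
      (\<integral>\<^sup>+z \<in> (S \<times> S) \<inter> strip (\<epsilon> * r). ennreal (\<bar>u (fst z) - u (snd z)\<bar> powr p) \<partial>(lebesgue \<Otimes>\<^sub>M lebesgue))"
    (is "?X \<le> ennreal ?C * ?Y")
proof -
  have near: "\<xi> \<in> \<Omega>" if "x \<in> V" "dist (\<psi> x) \<xi> \<le> \<epsilon> * K" for x \<xi>
  proof -
    have "dist x \<xi> \<le> \<epsilon> * (\<tau> + K)"
      using dist_triangle[of x \<xi> "\<psi> x"] \<psi>(3)[of x] that(2) by (simp add: algebra_simps)
    then show ?thesis using V(2)[OF that(1)] by auto
  qed
  have \<psi>S: "\<psi> x \<in> S" if "x \<in> V" for x
    using near[OF that, of "\<psi> x"] \<psi>(2) pos by (simp add: S_def)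
  have est: "emeasure lebesgue (ball (0 :: real ^ 'n) (\<epsilon> * \<sigma>)) * emeasure lebesgue (ball (0 :: real ^ 'n) (\<epsilon> * \<sigma>)) *
      ennreal (\<bar>u (\<psi> x) - u (\<psi> y)\<bar> powr p) \<le>
      ennreal (2 powr p) * (2 * ennreal (2 powr p)) ^ n *
      (emeasure lebesgue (ball (0 :: real ^ 'n) (\<epsilon> * \<sigma>)) * local_energy p (\<epsilon> * r) S u (\<psi> x) +
        (\<integral>\<^sup>+\<xi>\<in>cball (\<psi> x) (\<epsilon> * K). local_energy p (\<epsilon> * r) S u \<xi> \<partial>lebesgue) +
        emeasure lebesgue (ball (0 :: real ^ 'n) (\<epsilon> * \<sigma>)) * local_energy p (\<epsilon> * r) S u (\<psi> y))"
    if xy: "x \<in> V" "y \<in> V" "dist x y \<le> \<epsilon>" for x y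
  proof -
    obtain a b where a: "a \<in> E" "\<psi> x = \<epsilon> *\<^sub>R a" and b: "b \<in> E" "\<psi> y = \<epsilon> *\<^sub>R b"
      using \<psi>(2)[of x] \<psi>(2)[of y] by blast
    \<comment> \<open>Each point moves by at most \<open>\<epsilon> * \<tau>\<close>; dividing by
      \<epsilon> gives the distance \<open>1 + 2 * \<tau>\<close> for which chains are
      provided.\<close>
    have "dist (\<psi> x) (\<psi> y) \<le> \<epsilon> + 2 * (\<epsilon> * \<tau>)"
      using dist_triangle[of "\<psi> x" "\<psi> y" x] dist_triangle[of x "\<psi> y" y] \<psi>(3)[of x] \<psi>(3)[of y] xy(3)
      by (simp add: dist_commute)
    then have "\<epsilon> * dist a b \<le> \<epsilon> * (1 + 2 * \<tau>)"
      using pos by (simp add: a b dist_scaled algebra_simps)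
    then have "dist a b \<le> 1 + 2 * \<tau>" using pos by simp
    then obtain w where w: "\<And>i. i\<le>n \<Longrightarrow> ball (w i) \<sigma> \<subseteq> E \<inter> cball a K"
      "\<And>i \<xi> \<eta>. i<n \<Longrightarrow> \<xi>\<in>ball (w i) \<sigma> \<Longrightarrow> \<eta>\<in>ball (w (Suc i)) \<sigma> \<Longrightarrow> dist \<xi> \<eta> \<le> r"
      "ball (w 0) \<sigma> \<subseteq> cball a r" "ball (w n) \<sigma> \<subseteq> cball b r"
      using chain[OF a(1) b(1)] by blast
    have scaled: "\<exists>\<xi>'. \<xi> = \<epsilon> *\<^sub>R \<xi>' \<and> \<xi>' \<in> ball (w i) \<sigma>" if "\<xi> \<in> ball (\<epsilon> *\<^sub>R w i) (\<epsilon> * \<sigma>)" for \<xi> i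
    proof (intro exI conjI)
      show eq: "\<xi> = \<epsilon> *\<^sub>R ((1 / \<epsilon>) *\<^sub>R \<xi>)" using pos by simp
      have "\<epsilon> * dist (w i) ((1 / \<epsilon>) *\<^sub>R \<xi>) < \<epsilon> * \<sigma>"
        using that eq dist_scaled[OF pos(1), of "w i" "(1 / \<epsilon>) *\<^sub>R \<xi>"] by simp
      then show "(1 / \<epsilon>) *\<^sub>R \<xi> \<in> ball (w i) \<sigma>" using pos by simp
    qed
    have le: "dist (\<epsilon> *\<^sub>R c) (\<epsilon> *\<^sub>R \<xi>) \<le> \<epsilon> * s \<longleftrightarrow> dist c \<xi> \<le> s" for c \<xi> :: "real ^ 'n" and s
      using pos by (simp add: dist_scaled)
    show ?thesis
    proof (rule chain_estimate[OF u S \<open>p > 0\<close> _ \<psi>S \<psi>S, where w = "\<lambda>i. \<epsilon> *\<^sub>R w i"])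
      show "0 \<le> \<epsilon> * \<sigma>" using pos by simp
      show "x \<in> V" "y \<in> V" by fact+
      show "ball (\<epsilon> *\<^sub>R w i) (\<epsilon> * \<sigma>) \<subseteq> S \<inter> cball (\<psi> x) (\<epsilon> * K)" if "i \<le> n" for i
      proof
        fix \<xi> assume "\<xi> \<in> ball (\<epsilon> *\<^sub>R w i) (\<epsilon> * \<sigma>)"
        then obtain \<xi>' where \<xi>': "\<xi> = \<epsilon> *\<^sub>R \<xi>'" "\<xi>' \<in> ball (w i) \<sigma>" using scaled by blast
        then have "\<xi>' \<in> E" "dist a \<xi>' \<le> K" using w(1)[OF that] by auto
        then have "dist (\<psi> x) \<xi> \<le> \<epsilon> * K" "\<xi> \<in> (*\<^sub>R) \<epsilon> ` E" using a \<xi>' le by auto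
        then show "\<xi> \<in> S \<inter> cball (\<psi> x) (\<epsilon> * K)" using near[OF xy(1)] by (simp add: S_def)
      qed
      show "dist \<xi> \<eta> \<le> \<epsilon> * r"
        if "i < n" "\<xi> \<in> ball (\<epsilon> *\<^sub>R w i) (\<epsilon> * \<sigma>)" "\<eta> \<in> ball (\<epsilon> *\<^sub>R w (Suc i)) (\<epsilon> * \<sigma>)" for i \<xi> \<eta>
        using scaled[OF that(2)] scaled[OF that(3)] w(2)[OF that(1)] le by blast
      show "ball (\<epsilon> *\<^sub>R w 0) (\<epsilon> * \<sigma>) \<subseteq> cball (\<psi> x) (\<epsilon> * r)"
        using scaled[of _ 0] w(3) unfolding a(2) by (auto simp del: mem_ball simp: le dest!: scaled)
      show "ball (\<epsilon> *\<^sub>R w n) (\<epsilon> * \<sigma>) \<subseteq> cball (\<psi> y) (\<epsilon> * r)"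
        using w(4) unfolding b(2) by (auto simp del: mem_ball simp: le dest!: scaled)
    qed
  qed
  define \<omega> where "\<omega> = unit_ball_vol (real CARD('n))"
  define D :: real where "D = 2 powr p"
  have \<omega>: "\<omega> > 0" unfolding \<omega>_def by simp
  have D: "D > 0" by (simp add: D_def)
  define \<beta> where "\<beta> = \<omega> * (\<epsilon> * \<sigma>) ^ CARD('n)"
  have \<beta>: "\<beta> > 0" unfolding \<beta>_def using pos \<omega> by simp
  have vol: "emeasure lebesgue (ball (0 :: real ^ 'n) (\<epsilon> * \<sigma>)) = ennreal \<beta>"
    "emeasure lebesgue (cball (0 :: real ^ 'n) \<epsilon>) = ennreal (\<omega> * \<epsilon> ^ CARD('n))"
    "emeasure lebesgue (cball (0 :: real ^ 'n) (\<epsilon> * K)) = ennreal (\<omega> * (\<epsilon> * K) ^ CARD('n))"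
    using pos emeasure_lebesgue_ball[where 'a = "real ^ 'n", of "\<epsilon> * \<sigma>" 0]
      emeasure_lebesgue_ball[where 'a = "real ^ 'n", of "\<epsilon>" 0]
      emeasure_lebesgue_ball[where 'a = "real ^ 'n", of "\<epsilon> * K" 0]
    by (simp_all add: \<beta>_def \<omega>_def)
  have "ennreal \<beta> * ennreal \<beta> * ?X \<le> ennreal D * (2 * ennreal D) ^ n *
      (ennreal (\<omega> * \<epsilon> ^ CARD('n)) * ennreal m * (2 * ennreal \<beta> + ennreal (\<omega> * (\<epsilon> * K) ^ CARD('n))) * ?Y)"
    unfolding vol[symmetric] D_def
    using u \<psi>(1) pos by (intro integrate_chain_estimate[OF u S _ V(1) \<psi>(1,4)] est) auto
  also have "2 * ennreal \<beta> + ennreal (\<omega> * (\<epsilon> * K) ^ CARD('n)) = ennreal (2 * \<beta> + \<omega> * (\<epsilon> * K) ^ CARD('n))"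
    using \<beta> \<omega> pos by (simp add: ennreal_mult' ennreal_plus)
  also have "ennreal D * (2 * ennreal D) ^ n = ennreal (D * (2 * D) ^ n)"
  proof -
    have "2 * ennreal D = ennreal (2 * D)" by (simp add: ennreal_mult')
    then have "ennreal D * (2 * ennreal D) ^ n = ennreal D * ennreal (2 * D) ^ n" by (simp only:)
    also have "\<dots> = ennreal D * ennreal ((2 * D) ^ n)" using D by (subst ennreal_power) auto
    also have "\<dots> = ennreal (D * (2 * D) ^ n)" using D by (intro ennreal_mult'[symmetric]) simp
    finally show ?thesis .
  qed
  finally have "ennreal (\<beta> * \<beta>) * ?X \<le>
      ennreal (D * (2 * D) ^ n * (\<omega> * \<epsilon> ^ CARD('n) * m * (2 * \<beta> + \<omega> * (\<epsilon> * K) ^ CARD('n)))) * ?Y"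
    using \<beta> D \<omega> pos by (simp add: ennreal_mult mult.assoc del: ennreal_plus)
  \<comment> \<open>Cancellation in the extended reals is done by multiplying with the finite
    reciprocal.\<close>
  then have "ennreal (1 / (\<beta> * \<beta>)) * (ennreal (\<beta> * \<beta>) * ?X) \<le> ennreal (1 / (\<beta> * \<beta>)) *
      (ennreal (D * (2 * D) ^ n * (\<omega> * \<epsilon> ^ CARD('n) * m * (2 * \<beta> + \<omega> * (\<epsilon> * K) ^ CARD('n)))) * ?Y)"
    by (intro mult_left_mono) auto
  moreover have "ennreal (1 / (\<beta> * \<beta>)) * (ennreal (\<beta> * \<beta>) * ?X) = ?X"
    using \<beta> by (simp add: mult.assoc[symmetric] ennreal_mult[symmetric])
  moreover have "1 / (\<beta> * \<beta>) * (D * (2 * D) ^ n * (\<omega> * \<epsilon> ^ CARD('n) * m * (2 * \<beta> + \<omega> * (\<epsilon> * K) ^ CARD('n)))) = ?C"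
  proof -
    \<comment> \<open>The square of the unit ball volume times \<open>e\<close> occurs in numerator
      and denominator and cancels.\<close>
    define e where "e = \<epsilon> ^ CARD('n)"
    define s where "s = \<sigma> ^ CARD('n)"
    have "e > 0" "s > 0" using pos by (simp_all add: e_def s_def)
    then show ?thesis using \<omega>
      unfolding \<beta>_def power_mult_distrib e_def[symmetric] s_def[symmetric] D_def
      by (simp add: field_simps power2_eq_square)
  qed
  moreover have "ennreal (1 / (\<beta> * \<beta>)) *
      (ennreal (D * (2 * D) ^ n * (\<omega> * \<epsilon> ^ CARD('n) * m * (2 * \<beta> + \<omega> * (\<epsilon> * K) ^ CARD('n)))) * ?Y) =
      ennreal (1 / (\<beta> * \<beta>) * (D * (2 * D) ^ n * (\<omega> * \<epsilon> ^ CARD('n) * m * (2 * \<beta> + \<omega> * (\<epsilon> * K) ^ CARD('n))))) * ?Y"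
    using \<beta> by (subst ennreal_mult') (simp_all add: mult.assoc)
  ultimately show ?thesis by simp
qed

section \<open>Pullback operators between \<open>L^p\<close> spaces\<close>

lemma Lp_iff:
  assumes "S \<in> sets lebesgue"
  shows "u \<in> Lp p S \<longleftrightarrow> u \<in> borel_measurable (lebesgue_on S) \<and> (\<integral>\<^sup>+x\<in>S. ennreal (\<bar>u x\<bar> powr p) \<partial>lebesgue) < \<infinity>"
  using assms unfolding Lp_def
  by (auto simp: integrable_iff_bounded nn_integral_restrict_space)

lemma Lp_norm_eq:
  assumes "S \<in> sets lebesgue" and [measurable]: "u \<in> borel_measurable (lebesgue_on S)"
  shows "Lp_norm p S u = enn2real (\<integral>\<^sup>+x\<in>S. ennreal (\<bar>u x\<bar> powr p) \<partial>lebesgue) powr (1 / p)"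
  using assms unfolding Lp_norm_def
  by (subst integral_eq_nn_integral) (auto simp: nn_integral_restrict_space)

lemma Lp_diff:
  assumes S: "S \<in> sets lebesgue" and p: "p > 0" and u: "u \<in> Lp p S" and v: "v \<in> Lp p S"
  shows "(\<lambda>x. u x - v x) \<in> Lp p S"
proof -
  let ?I = "\<lambda>u. \<integral>\<^sup>+x. ennreal (\<bar>u x\<bar> powr p) \<partial>lebesgue_on S"
  have [measurable]: "u \<in> borel_measurable (lebesgue_on S)" "v \<in> borel_measurable (lebesgue_on S)"
    using u v by (auto simp: Lp_def)
  have "?I (\<lambda>x. u x - v x) \<le> (\<integral>\<^sup>+x. ennreal (2 powr p) * (ennreal (\<bar>u x\<bar> powr p) + ennreal (\<bar>v x\<bar> powr p)) \<partial>lebesgue_on S)"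
    \<comment> \<open>The triangle inequality is used with 0 as intermediate value.\<close>
    by (intro nn_integral_mono) (use ennreal_powr_triangle[OF p, of _ _ 0] in simp)
  also have "\<dots> = ennreal (2 powr p) * (?I u + ?I v)"
    by (simp add: nn_integral_cmult nn_integral_add)
  also have "\<dots> < \<infinity>"
    using u v S by (simp add: Lp_iff nn_integral_restrict_space ennreal_mult_less_top)
  finally show ?thesis using S by (simp add: Lp_iff nn_integral_restrict_space)
qed

text \<open>Reads \<open>u\<close> only on \<open>S\<close>, since representatives are arbitrary
  elsewhere; the default 0 preserves linearity.\<close>

definition pullback :: "('a \<Rightarrow> 'a) \<Rightarrow> 'a set \<Rightarrow> ('a \<Rightarrow> real) \<Rightarrow> 'a \<Rightarrow> real" where
  "pullback \<psi> S u x = (if \<psi> x \<in> S then u (\<psi> x) else 0)"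

context
  fixes \<psi> :: "real ^ 'n \<Rightarrow> real ^ 'n" and m p :: real and S :: "(real ^ 'n) set"
  assumes \<psi>: "\<psi> \<in> lebesgue \<rightarrow>\<^sub>M lebesgue"
    and push: "\<And>f. f \<in> borel_measurable lebesgue \<Longrightarrow>
        (\<integral>\<^sup>+x. f (\<psi> x) \<partial>lebesgue) \<le> ennreal m * (\<integral>\<^sup>+x. f x \<partial>lebesgue)"
    and S: "S \<in> sets lebesgue" and p: "p > 0" and m: "m > 0"
begin

lemma measurable_pullback:
  assumes "u \<in> borel_measurable (lebesgue_on S)"
  shows "pullback \<psi> S u \<in> borel_measurable lebesgue"
  using measurable_compose[OF \<psi> borel_measurable_if_I[OF assms S]] by (simp add: pullback_def[abs_def])

text \<open>The pullback is the extension of \<open>u\<close> by zero composed with \<psi>, so the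
  push-forward bound applies to its \<open>p\<close>-th power, whatever the target set
  \<open>B\<close>.\<close>

lemma nn_integral_pullback_le:
  assumes u: "u \<in> borel_measurable (lebesgue_on S)"
  shows "(\<integral>\<^sup>+x\<in>B. ennreal (\<bar>pullback \<psi> S u x\<bar> powr p) \<partial>lebesgue) \<le>
    ennreal m * (\<integral>\<^sup>+x\<in>S. ennreal (\<bar>u x\<bar> powr p) \<partial>lebesgue)"
proof -
  define u0 where "u0 x = (if x \<in> S then u x else 0)" for x
  have [measurable]: "u0 \<in> borel_measurable lebesgue"
    unfolding u0_def by (rule borel_measurable_if_I[OF u S])
  have "(\<integral>\<^sup>+x\<in>B. ennreal (\<bar>pullback \<psi> S u x\<bar> powr p) \<partial>lebesgue) \<le> (\<integral>\<^sup>+x. ennreal (\<bar>u0 (\<psi> x)\<bar> powr p) \<partial>lebesgue)"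
    by (intro nn_integral_mono) (auto simp: pullback_def u0_def split: split_indicator)
  also have "\<dots> \<le> ennreal m * (\<integral>\<^sup>+x. ennreal (\<bar>u0 x\<bar> powr p) \<partial>lebesgue)"
    by (rule push) measurable
  also have "(\<integral>\<^sup>+x. ennreal (\<bar>u0 x\<bar> powr p) \<partial>lebesgue) = (\<integral>\<^sup>+x\<in>S. ennreal (\<bar>u x\<bar> powr p) \<partial>lebesgue)"
    by (intro nn_integral_cong) (auto simp: u0_def split: split_indicator)
  finally show ?thesis .
qed

text \<open>The operator is pointwise linear, so differences of images are images of differences.
  The integral bound for these gives both independence of the representative and continuity.\<close>

lemma continuous_linear_pullback:
  assumes B: "B \<in> sets lebesgue"
  shows "continuous_linear_Lp p S B (pullback \<psi> S)"
proof -
  have pb_diff: "pullback \<psi> S v z - pullback \<psi> S u z = pullback \<psi> S (\<lambda>x. v x - u x) z" for u v z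
    by (simp add: pullback_def)
  have meas: "pullback \<psi> S u \<in> borel_measurable (lebesgue_on B)" if "u \<in> Lp p S" for u
    using measurable_pullback[of u] that by (auto simp: Lp_def intro: measurable_restrict_space1)
  have Lp: "pullback \<psi> S u \<in> Lp p B" if u: "u \<in> Lp p S" for u
  proof -
    have "(\<integral>\<^sup>+x\<in>B. ennreal (\<bar>pullback \<psi> S u x\<bar> powr p) \<partial>lebesgue) \<le>
        ennreal m * (\<integral>\<^sup>+x\<in>S. ennreal (\<bar>u x\<bar> powr p) \<partial>lebesgue)"
      using u by (intro nn_integral_pullback_le) (simp add: Lp_def)
    also have "\<dots> < \<infinity>" using u S by (simp add: Lp_iff ennreal_mult_less_top)
    finally show ?thesis using meas[OF u] B by (simp add: Lp_iff)
  qed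
  have AE: "AE x in lebesgue_on B. pullback \<psi> S u x = pullback \<psi> S v x"
    if u: "u \<in> Lp p S" and v: "v \<in> Lp p S" and eq: "AE x in lebesgue_on S. u x = v x" for u v
  proof -
    have d: "(\<lambda>x. u x - v x) \<in> borel_measurable (lebesgue_on S)"
      using Lp_diff[OF S p u v] by (simp add: Lp_def)
    have [measurable]: "pullback \<psi> S (\<lambda>x. u x - v x) \<in> borel_measurable lebesgue"
      by (rule measurable_pullback[OF d])
    have "(\<integral>\<^sup>+x\<in>S. ennreal (\<bar>u x - v x\<bar> powr p) \<partial>lebesgue) = (\<integral>\<^sup>+x. ennreal (\<bar>u x - v x\<bar> powr p) \<partial>lebesgue_on S)"
      using S by (simp add: nn_integral_restrict_space)
    also have "\<dots> = (\<integral>\<^sup>+x. 0 \<partial>lebesgue_on S)"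
      by (intro nn_integral_cong_AE) (use eq in eventually_elim, simp)
    finally have "(\<integral>\<^sup>+x\<in>UNIV. ennreal (\<bar>pullback \<psi> S (\<lambda>x. u x - v x) x\<bar> powr p) \<partial>lebesgue) \<le> 0"
      using nn_integral_pullback_le[OF d, of UNIV] by simp
    then have "AE x in lebesgue. ennreal (\<bar>pullback \<psi> S (\<lambda>x. u x - v x) x\<bar> powr p) = 0"
      by (subst nn_integral_0_iff_AE[symmetric]) auto
    then have "AE x in lebesgue. pullback \<psi> S u x = pullback \<psi> S v x"
      by eventually_elim (use p in \<open>simp add: pb_diff[symmetric]\<close>)
    then have "AE x in lebesgue. x \<in> B \<longrightarrow> pullback \<psi> S u x = pullback \<psi> S v x"
      by eventually_elim simp
    then show ?thesis using B by (simp add: AE_restrict_space_iff)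
  qed
  have cont: "\<exists>\<delta>>0. \<forall>v \<in> Lp p S. Lp_norm p S (\<lambda>z. v z - u z) < \<delta> \<longrightarrow>
      Lp_norm p B (\<lambda>z. pullback \<psi> S v z - pullback \<psi> S u z) < e"
    if u: "u \<in> Lp p S" and e: "e > 0" for u e
  \<comment> \<open>The \<open>p\<close>-th root of \<open>m\<close> bounds the operator
    norm.\<close>
  proof (intro exI[of _ "e / m powr (1 / p)"] conjI ballI impI)
    show "0 < e / m powr (1 / p)" using e m by simp
    fix v assume v: "v \<in> Lp p S" and less: "Lp_norm p S (\<lambda>z. v z - u z) < e / m powr (1 / p)"
    let ?d = "\<lambda>x. v x - u x"
    let ?I = "\<integral>\<^sup>+x\<in>S. ennreal (\<bar>?d x\<bar> powr p) \<partial>lebesgue"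
    have d: "?d \<in> Lp p S" by (rule Lp_diff[OF S p v u])
    then have dm: "?d \<in> borel_measurable (lebesgue_on S)" and fin: "?I < \<infinity>"
      using S by (simp_all add: Lp_iff)
    have "enn2real (\<integral>\<^sup>+x\<in>B. ennreal (\<bar>pullback \<psi> S ?d x\<bar> powr p) \<partial>lebesgue) \<le> enn2real (ennreal m * ?I)"
      using fin by (intro enn2real_mono nn_integral_pullback_le dm) (simp add: ennreal_mult_less_top)
    also have "\<dots> = m * enn2real ?I" using m by (simp add: enn2real_mult)
    finally have "Lp_norm p B (pullback \<psi> S ?d) \<le> (m * enn2real ?I) powr (1 / p)"
      using p by (subst Lp_norm_eq[OF B meas[OF d]]) (intro powr_mono2, auto)
    also have "\<dots> = m powr (1 / p) * Lp_norm p S ?d"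
      using m by (simp add: powr_mult Lp_norm_eq[OF S dm])
    also have "\<dots> < e" using less m by (simp add: field_simps)
    finally show "Lp_norm p B (\<lambda>z. pullback \<psi> S v z - pullback \<psi> S u z) < e"
      unfolding pb_diff .
  qed
  show ?thesis
    unfolding continuous_linear_Lp_def using Lp AE cont by (auto simp: pullback_def)
qed

end

text \<open>The order of choices yields the claimed dependence: \<tau>, \<open>m\<close> and
  \<open>K\<close> come from \<open>E\<close>, chain length and radius from \<open>E\<close> and
  \<open>r\<close>, and only then enter \<open>p\<close>, \<Omega> and \<epsilon>. The witnesses are
  \<open>R = 1\<close>, \<open>c1 = m\<close> and \<open>k0 = \<tau> + K\<close>.\<close>

lemma (in periodic_domain) extension_operator:
  assumes "E \<noteq> {}"
  shows "\<exists>R>0. \<forall>p>1. \<exists>(c1::real) (c2 :: real \<Rightarrow> real).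
    c1 > 0 \<and> (\<forall>r>0. c2 r > 0) \<and>
    (\<forall>\<Omega> :: (real ^ 'n) set. bounded \<Omega> \<and> open \<Omega> \<longrightarrow>
      (\<exists>k0>0. \<forall>\<epsilon>>0. \<exists>T :: (real ^ 'n \<Rightarrow> real) \<Rightarrow> (real ^ 'n \<Rightarrow> real).
        continuous_linear_Lp p (\<Omega> \<inter> (*\<^sub>R) \<epsilon> ` E) \<Omega> T \<and>
        (\<forall>r>0. \<forall>u \<in> Lp p (\<Omega> \<inter> (*\<^sub>R) \<epsilon> ` E).
          (AE x in lebesgue_on (\<Omega> \<inter> (*\<^sub>R) \<epsilon> ` E). T u x = u x) \<and>
          (\<integral>\<^sup>+x \<in> inner_set \<Omega> (\<epsilon> * k0). ennreal (\<bar>T u x\<bar> powr p) \<partial>lebesgue)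
            \<le> ennreal c1 * (\<integral>\<^sup>+x \<in> \<Omega> \<inter> (*\<^sub>R) \<epsilon> ` E. ennreal (\<bar>u x\<bar> powr p) \<partial>lebesgue) \<and>
          (\<integral>\<^sup>+z \<in> (inner_set \<Omega> (\<epsilon> * k0) \<times> inner_set \<Omega> (\<epsilon> * k0)) \<inter> strip (\<epsilon> * R).
              ennreal (\<bar>T u (fst z) - T u (snd z)\<bar> powr p) \<partial>(lebesgue \<Otimes>\<^sub>M lebesgue))
            \<le> ennreal (c2 r) *
              (\<integral>\<^sup>+z \<in> ((\<Omega> \<inter> (*\<^sub>R) \<epsilon> ` E) \<times> (\<Omega> \<inter> (*\<^sub>R) \<epsilon> ` E)) \<inter> strip (\<epsilon> * r).
                ennreal (\<bar>u (fst z) - u (snd z)\<bar> powr p) \<partial>(lebesgue \<Otimes>\<^sub>M lebesgue)))))"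
    (is "\<exists>R>0. \<forall>p>1. ?concl p R")
proof -
  obtain \<tau> m where \<tau>: "\<tau> > 0" and m: "m > 0" and retr: "\<And>\<epsilon>. \<epsilon> > 0 \<Longrightarrow> \<exists>\<psi>. \<psi> \<in> lebesgue \<rightarrow>\<^sub>M lebesgue \<and>
      (\<forall>x. \<psi> x \<in> (*\<^sub>R) \<epsilon> ` E \<and> dist x (\<psi> x) \<le> \<epsilon> * \<tau>) \<and> (\<forall>x \<in> (*\<^sub>R) \<epsilon> ` E. \<psi> x = x) \<and>
      (\<forall>f\<in>borel_measurable lebesgue. (\<integral>\<^sup>+x. f (\<psi> x) \<partial>lebesgue) \<le> ennreal m * (\<integral>\<^sup>+x. f x \<partial>lebesgue))"
    using retraction[OF assms] by auto
  obtain K where K: "K > 0" and chains: "\<And>r. 0 < r \<Longrightarrow> r \<le> 1 \<Longrightarrow> \<exists>n \<sigma>. \<sigma> > 0 \<and>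
      (\<forall>x\<in>E. \<forall>y\<in>E. dist x y \<le> 1 + 2 * \<tau> \<longrightarrow>
      (\<exists>w. (\<forall>i\<le>n. ball (w i) \<sigma> \<subseteq> E \<inter> cball x K) \<and>
        (\<forall>i<n. \<forall>\<xi>\<in>ball (w i) \<sigma>. \<forall>\<eta>\<in>ball (w (Suc i)) \<sigma>. dist \<xi> \<eta> \<le> r) \<and>
        ball (w 0) \<sigma> \<subseteq> cball x r \<and> ball (w n) \<sigma> \<subseteq> cball y r))"
    using ball_chains[of "1 + 2 * \<tau>"] by auto
  define good where "good r n \<sigma> \<longleftrightarrow> \<sigma> > 0 \<and> (\<forall>x\<in>E. \<forall>y\<in>E. dist x y \<le> 1 + 2 * \<tau> \<longrightarrow>
      (\<exists>w. (\<forall>i\<le>n. ball (w i) \<sigma> \<subseteq> E \<inter> cball x K) \<and>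
        (\<forall>i<n. \<forall>\<xi>\<in>ball (w i) \<sigma>. \<forall>\<eta>\<in>ball (w (Suc i)) \<sigma>. dist \<xi> \<eta> \<le> r) \<and>
        ball (w 0) \<sigma> \<subseteq> cball x r \<and> ball (w n) \<sigma> \<subseteq> cball y r))" for r \<sigma> and n :: nat
  \<comment> \<open>Chains are available for meshes up to 1, so \<open>r\<close> is capped. Choosing
    \<open>q\<close> as a function of \<open>r\<close> makes \<open>c2\<close> a function fixed
    before \<Omega> and \<epsilon>.\<close>
  have "\<forall>r. \<exists>q. 0 < r \<longrightarrow> good (min r 1) (fst q) (snd q)"
    using chains[of "min r 1" for r] unfolding good_def by simp
  then obtain q where q: "\<And>r. 0 < r \<Longrightarrow> good (min r 1) (fst (q r)) (snd (q r))"
    unfolding choice_iff by blast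
  define c2 where "c2 p r = 2 powr p * (2 * 2 powr p) ^ fst (q r) * m *
      (2 * snd (q r) ^ CARD('n) + K ^ CARD('n)) / (snd (q r) ^ CARD('n))\<^sup>2" for p r
  have c2: "c2 p r > 0" if "r > 0" for p r
    using q[OF that] m K by (simp add: c2_def good_def add_pos_pos)
  show ?thesis
  proof (rule exI[of _ "1 :: real"], intro conjI allI impI)
    fix p :: real assume p: "p > 1"
    show "?concl p 1"
    proof (rule exI[of _ m], rule exI[of _ "c2 p"], intro conjI allI impI m c2, assumption,
        rule exI[of _ "\<tau> + K"], intro conjI allI impI)
      show "0 < \<tau> + K" using \<tau> K by simp
      fix \<Omega> :: "(real ^ 'n) set" and \<epsilon> :: real
      assume \<Omega>: "bounded \<Omega> \<and> open \<Omega>" and \<epsilon>: "\<epsilon> > 0"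
      define S where "S = \<Omega> \<inter> (*\<^sub>R) \<epsilon> ` E"
      define V where "V = inner_set \<Omega> (\<epsilon> * (\<tau> + K))"
      have "open S" unfolding S_def using \<Omega> \<epsilon> opn by (intro open_Int open_scaling) auto
      then have S: "S \<in> sets lebesgue" by (simp add: lborelD)
      have \<Omega>_sets: "\<Omega> \<in> sets lebesgue" using \<Omega> by (simp add: lborelD)
      have "open V" unfolding V_def using \<Omega> by (intro open_inner_set) simp
      then have V: "V \<in> sets lebesgue" by (simp add: lborelD)
      obtain \<psi> where \<psi>: "\<psi> \<in> lebesgue \<rightarrow>\<^sub>M lebesgue" "\<And>x. \<psi> x \<in> (*\<^sub>R) \<epsilon> ` E" "\<And>x. dist x (\<psi> x) \<le> \<epsilon> * \<tau>"
        "\<And>x. x \<in> (*\<^sub>R) \<epsilon> ` E \<Longrightarrow> \<psi> x = x"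
        "\<And>f. f \<in> borel_measurable lebesgue \<Longrightarrow>
          (\<integral>\<^sup>+x. f (\<psi> x) \<partial>lebesgue) \<le> ennreal m * (\<integral>\<^sup>+x. f x \<partial>lebesgue)"
        using retr[OF \<epsilon>] by blast
      have p0: "p > 0" using p by simp
      let ?T = "pullback \<psi> S"
      have "continuous_linear_Lp p S \<Omega> ?T"
        by (rule continuous_linear_pullback[OF \<psi>(1,5) S p0 m \<Omega>_sets])
      moreover have "AE x in lebesgue_on S. ?T u x = u x" for u
        by (rule AE_I2) (auto simp: space_restrict_space pullback_def S_def \<psi>(4))
      moreover have "(\<integral>\<^sup>+x \<in> V. ennreal (\<bar>?T u x\<bar> powr p) \<partial>lebesgue)
            \<le> ennreal m * (\<integral>\<^sup>+x \<in> S. ennreal (\<bar>u x\<bar> powr p) \<partial>lebesgue)" if "u \<in> Lp p S" for u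
      proof -
        have "u \<in> borel_measurable (lebesgue_on S)" using that unfolding Lp_def by simp
        then show ?thesis using \<psi>(1,5) S p0 m by (intro nn_integral_pullback_le) auto
      qed
      moreover have "(\<integral>\<^sup>+z \<in> (V \<times> V) \<inter> strip (\<epsilon> * 1). ennreal (\<bar>?T u (fst z) - ?T u (snd z)\<bar> powr p) \<partial>(lebesgue \<Otimes>\<^sub>M lebesgue))
            \<le> ennreal (c2 p r) *
              (\<integral>\<^sup>+z \<in> (S \<times> S) \<inter> strip (\<epsilon> * r). ennreal (\<bar>u (fst z) - u (snd z)\<bar> powr p) \<partial>(lebesgue \<Otimes>\<^sub>M lebesgue))"
        if u: "u \<in> Lp p S" and r: "r > 0" for u r
      proof -
        \<comment> \<open>The energy estimate wants a function measurable on the whole space, so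
          \<open>u\<close> is extended by zero.\<close>
        define u0 where "u0 x = (if x \<in> S then u x else 0)" for x
        have u0: "u0 \<in> borel_measurable lebesgue"
          unfolding u0_def using u Lp_iff[OF S, of u p] by (intro borel_measurable_if_I S) blast
        have T: "?T u x = u0 (\<psi> x)" for x by (simp add: pullback_def u0_def)
        have "(\<integral>\<^sup>+z \<in> (V \<times> V) \<inter> strip \<epsilon>. ennreal (\<bar>u0 (\<psi> (fst z)) - u0 (\<psi> (snd z))\<bar> powr p) \<partial>(lebesgue \<Otimes>\<^sub>M lebesgue))
            \<le> ennreal (c2 p r) *
              (\<integral>\<^sup>+z \<in> (S \<times> S) \<inter> strip (\<epsilon> * min r 1). ennreal (\<bar>u0 (fst z) - u0 (snd z)\<bar> powr p) \<partial>(lebesgue \<Otimes>\<^sub>M lebesgue))"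
          unfolding c2_def S_def
        proof (rule retraction_energy[where \<tau> = \<tau>])
          show "\<exists>w. (\<forall>i\<le>fst (q r). ball (w i) (snd (q r)) \<subseteq> E \<inter> cball x K) \<and>
            (\<forall>i<fst (q r). \<forall>\<xi>\<in>ball (w i) (snd (q r)). \<forall>\<eta>\<in>ball (w (Suc i)) (snd (q r)). dist \<xi> \<eta> \<le> min r 1) \<and>
            ball (w 0) (snd (q r)) \<subseteq> cball x (min r 1) \<and> ball (w (fst (q r))) (snd (q r)) \<subseteq> cball y (min r 1)"
            if "x \<in> E" "y \<in> E" "dist x y \<le> 1 + 2 * \<tau>" for x y
            using q[OF r] that unfolding good_def by blast
          show "0 < snd (q r)" using q[OF r] by (simp add: good_def)
          show "cball x (\<epsilon> * (\<tau> + K)) \<subseteq> \<Omega>" if "x \<in> V" for x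
            using that \<epsilon> \<tau> K unfolding V_def by (intro cball_subset_of_inner_set) auto
        qed (use \<epsilon> \<tau> K m p0 \<psi> u0 S V in \<open>auto simp: S_def\<close>)
        \<comment> \<open>Undoing the cap only enlarges the strip, and \<open>u0\<close> agrees with
          \<open>u\<close> on \<open>S\<close>.\<close>
        also have "(\<integral>\<^sup>+z \<in> (S \<times> S) \<inter> strip (\<epsilon> * min r 1). ennreal (\<bar>u0 (fst z) - u0 (snd z)\<bar> powr p) \<partial>(lebesgue \<Otimes>\<^sub>M lebesgue))
            \<le> (\<integral>\<^sup>+z \<in> (S \<times> S) \<inter> strip (\<epsilon> * r). ennreal (\<bar>u (fst z) - u (snd z)\<bar> powr p) \<partial>(lebesgue \<Otimes>\<^sub>M lebesgue))"
        proof (intro nn_integral_mono)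
          fix z :: "(real ^ 'n) \<times> (real ^ 'n)"
          have "\<epsilon> * min r 1 \<le> \<epsilon> * r" using \<epsilon> by simp
          then have "strip (\<epsilon> * min r 1) \<subseteq> (strip (\<epsilon> * r) :: ((real ^ 'n) \<times> (real ^ 'n)) set)"
            by (auto simp: strip_def)
          then show "ennreal (\<bar>u0 (fst z) - u0 (snd z)\<bar> powr p) * indicator ((S \<times> S) \<inter> strip (\<epsilon> * min r 1)) z
              \<le> ennreal (\<bar>u (fst z) - u (snd z)\<bar> powr p) * indicator ((S \<times> S) \<inter> strip (\<epsilon> * r)) z"
            by (auto simp: u0_def split: split_indicator)
        qed
        finally show ?thesis by (simp add: T mult_left_mono)
      qed
      ultimately show "\<exists>T :: (real ^ 'n \<Rightarrow> real) \<Rightarrow> (real ^ 'n \<Rightarrow> real).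
        continuous_linear_Lp p (\<Omega> \<inter> (*\<^sub>R) \<epsilon> ` E) \<Omega> T \<and>
        (\<forall>r>0. \<forall>u \<in> Lp p (\<Omega> \<inter> (*\<^sub>R) \<epsilon> ` E).
          (AE x in lebesgue_on (\<Omega> \<inter> (*\<^sub>R) \<epsilon> ` E). T u x = u x) \<and>
          (\<integral>\<^sup>+x \<in> inner_set \<Omega> (\<epsilon> * (\<tau> + K)). ennreal (\<bar>T u x\<bar> powr p) \<partial>lebesgue)
            \<le> ennreal m * (\<integral>\<^sup>+x \<in> \<Omega> \<inter> (*\<^sub>R) \<epsilon> ` E. ennreal (\<bar>u x\<bar> powr p) \<partial>lebesgue) \<and>
          (\<integral>\<^sup>+z \<in> (inner_set \<Omega> (\<epsilon> * (\<tau> + K)) \<times> inner_set \<Omega> (\<epsilon> * (\<tau> + K))) \<inter> strip (\<epsilon> * 1).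
              ennreal (\<bar>T u (fst z) - T u (snd z)\<bar> powr p) \<partial>(lebesgue \<Otimes>\<^sub>M lebesgue))
            \<le> ennreal (c2 p r) *
              (\<integral>\<^sup>+z \<in> ((\<Omega> \<inter> (*\<^sub>R) \<epsilon> ` E) \<times> (\<Omega> \<inter> (*\<^sub>R) \<epsilon> ` E)) \<inter> strip (\<epsilon> * r).
                ennreal (\<bar>u (fst z) - u (snd z)\<bar> powr p) \<partial>(lebesgue \<Otimes>\<^sub>M lebesgue)))"
        unfolding S_def[symmetric] V_def[symmetric] by (intro exI[of _ ?T]) blast
    qed
  qed simp
qed

theorem theorem2p2:
  fixes E :: "(real ^ 'n) set"
  assumes "periodic_set E" and "connected E" and "open E" and "lipschitz_boundary E"
  shows "\<exists>R>0. \<forall>p>1. \<exists>(c1::real) (c2 :: real \<Rightarrow> real).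
    c1 > 0 \<and> (\<forall>r>0. c2 r > 0) \<and>
    (\<forall>\<Omega> :: (real ^ 'n) set. bounded \<Omega> \<and> open \<Omega> \<longrightarrow>
      (\<exists>k0>0. \<forall>\<epsilon>>0. \<exists>T :: (real ^ 'n \<Rightarrow> real) \<Rightarrow> (real ^ 'n \<Rightarrow> real).
        continuous_linear_Lp p (\<Omega> \<inter> (*\<^sub>R) \<epsilon> ` E) \<Omega> T \<and>
        (\<forall>r>0. \<forall>u \<in> Lp p (\<Omega> \<inter> (*\<^sub>R) \<epsilon> ` E).
          (AE x in lebesgue_on (\<Omega> \<inter> (*\<^sub>R) \<epsilon> ` E). T u x = u x) \<and>
          (\<integral>\<^sup>+x \<in> inner_set \<Omega> (\<epsilon> * k0). ennreal (\<bar>T u x\<bar> powr p) \<partial>lebesgue)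
            \<le> ennreal c1 * (\<integral>\<^sup>+x \<in> \<Omega> \<inter> (*\<^sub>R) \<epsilon> ` E. ennreal (\<bar>u x\<bar> powr p) \<partial>lebesgue) \<and>
          (\<integral>\<^sup>+z \<in> (inner_set \<Omega> (\<epsilon> * k0) \<times> inner_set \<Omega> (\<epsilon> * k0)) \<inter> strip (\<epsilon> * R).
              ennreal (\<bar>T u (fst z) - T u (snd z)\<bar> powr p) \<partial>(lebesgue \<Otimes>\<^sub>M lebesgue))
            \<le> ennreal (c2 r) *
              (\<integral>\<^sup>+z \<in> ((\<Omega> \<inter> (*\<^sub>R) \<epsilon> ` E) \<times> (\<Omega> \<inter> (*\<^sub>R) \<epsilon> ` E)) \<inter> strip (\<epsilon> * r).
                ennreal (\<bar>u (fst z) - u (snd z)\<bar> powr p) \<partial>(lebesgue \<Otimes>\<^sub>M lebesgue)))))"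
proof (cases "E = {}")
  case True
  \<comment> \<open>For empty \<open>E\<close> the zero operator satisfies all bounds, with every
    constant equal to 1.\<close>
  show ?thesis
    unfolding True
    by (intro exI[of _ "1 :: real"] conjI allI impI exI[of _ "\<lambda>_. 1 :: real"] exI[of _ "\<lambda>u x. 0 :: real"])
      (auto simp: continuous_linear_Lp_def Lp_def Lp_norm_def)
next
  case False
  interpret periodic_domain E
  proof
    show "\<exists>U. open U \<and> bounded U \<and> x \<in> U \<and> connected (E \<inter> U)" if "x \<in> frontier E" for x
      using assms(4) that lipschitz_boundary_neighbourhood unfolding lipschitz_boundary_def by blast
  qed (use assms in auto)
  show ?thesis by (rule extension_operator[OF False])
qed

end
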